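(* Let $\mathcal{M}=\{M_1,M_2\}$ be a binary MMDP, let $\mathcal{M}^{\mathrm p}=\{M_1^{\mathrm p},M_2^{\mathrm p}\}$ be its preprocessed MMDP, and let $M^{\mathrm I}=(\mathcal{S}^{\mathrm p},\mathcal{A}^{\mathrm p},\delta^{\mathrm I},s_{\mathrm{init}})$, with $\delta^{\mathrm I}=\gamma\delta_1^{\mathrm p}+(1-\gamma)\delta_2^{\mathrm p}$ for some $\gamma\in(0,1)$, be any of its informative MDPs. Then a policy $\boldsymbol{\pi}$ achieves asymptotic perfect detection (APD) for $\mathcal{M}$ if and only if $$\mathcal{P}_{\mathrm I}^{\boldsymbol{\pi}}\big(\{h\in\mathcal{H}^{\mathrm I}:\ \mathrm{inft}(h)\cap \mathrm{ISA}^{\mathrm p}\neq\emptyset\}\big)=1,$$ where $\mathcal{P}_{\mathrm I}^{\boldsymbol{\pi}}$ is the probability measure induced by the kernel $\delta^{\mathrm I}$ and the policy $\boldsymbol{\pi}$ on the measurable space $(\mathcal{H}^{\mathrm I},\mathcal{Q}^{\mathrm I})$ of infinite histories of $M^{\mathrm I}$.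
   Context: **MDPs and policies.** An MDP is $M=(\mathcal{S},\mathcal{A},\delta,s_{\mathrm{init}})$ with a finite state set $\mathcal{S}$, finite nonempty action sets $\mathcal{A}_s$ ($s\in\mathcal{S}$), $\mathcal{A}=\cup_s\mathcal{A}_s$, a kernel $\delta(s'|s,a)\in[0,1]$ for $s,s'\in\mathcal{S}$, $a\in\mathcal{A}_s$, with $\sum_{s'}\delta(s'|s,a)=1$, and an initial state $s_{\mathrm{init}}$. $\mathrm{Supp}(p)$ is the support of a probability mass function $p$. A history at step $t$ is $h_t=(s_0,a_0,\dots,s_t)$ with $s_0=s_{\mathrm{init}}$, $a_\tau\in\mathcal{A}_{s_\tau}$, $\delta(s_{\tau+1}|s_\tau,a_\tau)>0$. A (history-dependent randomized) policy $\boldsymbol{\pi}=(\pi_0,\pi_1,\dots)$ assigns to each history $h_t$ ending in $s_t$ a probability distribution $\pi_t(\cdot|h_t)$ on $\mathcal{A}_{s_t}$. **Binary MMDP and APD.** A binary MMDP $\mathcal{M}=\{M_1,M_2\}$ is a pair of MDPs $M_i=(\mathcal{S},\mathcal{A},\delta_i,s_{\mathrm{init}})$ with the same states, available actions and initial state. $\mathcal{H}_t$ is the union of the sets of step-$t$ histories of $M_1$ and $M_2$ (policies are defined on these), and $\mathbb{P}_i^{\boldsymbol\pi}(h_t)$ is the probability of $h_t$ in $M_i$ under $\boldsymbol\pi$. For an estimated prior $q\in(0,1)$ and a true prior $\theta\in(0,1)$ of $M_1$, the error probability of the maximum a posteriori rule based on $h_t$ is $$P_{\mathrm{error}}(t,q,\theta)=\theta\sum_{h_t:\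 q\mathbb{P}_1^{\boldsymbol\pi}(h_t)\le(1-q)\mathbb{P}_2^{\boldsymbol\pi}(h_t)}\mathbb{P}_1^{\boldsymbol\pi}(h_t)+(1-\theta)\sum_{h_t:\ q\mathbb{P}_1^{\boldsymbol\pi}(h_t)\ge(1-q)\mathbb{P}_2^{\boldsymbol\pi}(h_t)}\mathbb{P}_2^{\boldsymbol\pi}(h_t).$$ The policy $\boldsymbol\pi$ achieves APD for $\mathcal{M}$ if $\lim_{t\to\infty}P_{\mathrm{error}}(t,q,\theta)=0$ for all $q,\theta\in(0,1)$. **Informative and revealing pairs.** For $s\in\mathcal{S},a\in\mathcal{A}_s$, the pair $(s,a)$ is *revealing* if $\mathrm{Supp}(\delta_1(\cdot|s,a))\cap\mathrm{Supp}(\delta_2(\cdot|s,a))=\emptyset$; it is *informative* if $\delta_1(\cdot|s,a)\ne\delta_2(\cdot|s,a)$ and these supports intersect. A state $s$ is revealing if $(s,a)$ is revealing for some $a\in\mathcal{A}_s$ (then $a$ is a revealing action). $\mathrm{ISA}$ is the set of informative pairs of $\mathcal{M}$. A transition $(s,a,s')$ is identity-revealing if exactly one of $\delta_1(s'|s,a),\delta_2(s'|s,a)$ is positive. **Preprocessed MMDP.** $M_i^{\mathrm p}=(\mathcal{S}^{\mathrm p},\mathcal{A}^{\mathrm p},\delta_i^{\mathrm p},s_{\mathrm{init}})$, $i\in\{1,2\}$, where $\mathcal{S}^{\mathrm p}=\mathcal{S}\cup\{\bot_1,\bot_2\}$ with two new states; $\mathcal{A}^{\mathrm p}_s=\mathcal{A}_s$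 if $s\in\mathcal{S}$ is not revealing; $\mathcal{A}^{\mathrm p}_s=\{a\}$ for one chosen revealing action $a\in\mathcal{A}_s$ if $s\in\mathcal{S}$ is revealing; $\mathcal{A}^{\mathrm p}_{\bot_j}=\{a^{\bot_j}\}$. Kernels: $\delta_i^{\mathrm p}(\bot_j|\bot_j,a^{\bot_j})=1$ for $j\in\{1,2\}$; if $s$ is revealing, $\delta_i^{\mathrm p}(\bot_i|s,a)=1$ for the unique $a\in\mathcal{A}^{\mathrm p}_s$; if $s$ is not revealing and $(s,a)$ is not informative, $\delta_i^{\mathrm p}(\cdot|s,a)=\delta_i(\cdot|s,a)$; if $s$ is not revealing and $(s,a)$ is informative, $\delta_i^{\mathrm p}(s'|s,a)=\delta_i(s'|s,a)$ for $s'\in\mathrm{Supp}(\delta_1(\cdot|s,a))\cap\mathrm{Supp}(\delta_2(\cdot|s,a))$, and $\delta_i^{\mathrm p}(\bot_i|s,a)$ is the remaining mass $\sum_{s'\in\mathrm{Supp}(\delta_i(\cdot|s,a))\setminus\mathrm{Supp}(\delta_{3-i}(\cdot|s,a))}\delta_i(s'|s,a)$. Put $\mathrm{ISA}^{\mathrm p}=\mathrm{ISA}\cup\{(\bot_1,a^{\bot_1}),(\bot_2,a^{\bot_2})\}$. **Convention on policies.** The policies considered are those of the preprocessed MMDP: a policy $\boldsymbol\pi$ of $\mathcal{M}^{\mathrm p}$ is used on $\mathcal{M}$ by prescribing the same action distributions on histories containing no identity-revealing transition (so that in revealing states it plays the retained revealing action), and arbitrarily after an identity-revealing transition has occurred.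 **Infinite histories.** $\mathcal{H}^{\mathrm I}$ is the set of infinite histories of $M^{\mathrm I}$ and $\mathcal{Q}^{\mathrm I}$ the $\sigma$-algebra generated by its cylinder sets. For an infinite history $h$, $\mathrm{inft}(h)$ is the set of state-action pairs that occur infinitely often in $h$. *)

theory Defs
  imports "HOL-Probability.Probability"
begin

record ('s, 'a) mdp =
  states :: "'s set"
  acts :: "'s \<Rightarrow> 'a set"
  kernel :: "'s \<Rightarrow> 'a \<Rightarrow> 's pmf"
  init :: 's

definition is_mdp :: "('s, 'a) mdp \<Rightarrow> bool" where
  "is_mdp M \<longleftrightarrow>
     finite (states M) \<and> init M \<in> states M \<and>
     (\<forall>s\<in>states M. finite (acts M s) \<and> acts M s \<noteq> {} \<and>
        (\<forall>a\<in>acts M s. set_pmf (kernel M s a) \<subseteq> states M))"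

text \<open>A finite history \<open>(s\<^sub>0, a\<^sub>0, \<dots>, a\<^bsub>t-1\<^esub>, s\<^sub>t)\<close> is encoded as
  \<open>([(s\<^sub>0, a\<^sub>0), \<dots>, (s\<^bsub>t-1\<^esub>, a\<^bsub>t-1\<^esub>)], s\<^sub>t)\<close>.\<close>

type_synonym ('s, 'a) hist = "('s \<times> 'a) list \<times> 's"

definition hstep :: "('s, 'a) hist \<Rightarrow> nat" where
  "hstep h = length (fst h)"

definition hstate :: "('s, 'a) hist \<Rightarrow> nat \<Rightarrow> 's" where
  "hstate h \<tau> = (map fst (fst h) @ [snd h]) ! \<tau>"

definition haction :: "('s, 'a) hist \<Rightarrow> nat \<Rightarrow> 'a" where
  "haction h \<tau> = snd (fst h ! \<tau>)"

definition hprefix :: "('s, 'a) hist \<Rightarrow> nat \<Rightarrow> ('s, 'a) hist" where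
  "hprefix h \<tau> = (take \<tau> (fst h), hstate h \<tau>)"

definition histories :: "('s, 'a) mdp \<Rightarrow> nat \<Rightarrow> ('s, 'a) hist set" where
  "histories M t = {h. hstep h = t \<and> hstate h 0 = init M \<and>
     (\<forall>\<tau><t. haction h \<tau> \<in> acts M (hstate h \<tau>) \<and>
        pmf (kernel M (hstate h \<tau>) (haction h \<tau>)) (hstate h (Suc \<tau>)) > 0)}"

text \<open>Policies are total functions on the history type; only their values on actual histories
  are ever constrained or used.\<close>

type_synonym ('s, 'a) policy = "('s, 'a) hist \<Rightarrow> 'a pmf"

definition hist_prob :: "('s, 'a) mdp \<Rightarrow> ('s, 'a) policy \<Rightarrow> ('s, 'a) hist \<Rightarrow> real" where
  "hist_prob M \<pi> h = (if hstate h 0 = init M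
     then \<Prod>\<tau><hstep h. pmf (\<pi> (hprefix h \<tau>)) (haction h \<tau>) *
            pmf (kernel M (hstate h \<tau>) (haction h \<tau>)) (hstate h (Suc \<tau>))
     else 0)"

text \<open>An infinite history \<open>(s\<^sub>0, a\<^sub>0, s\<^sub>1, a\<^sub>1, \<dots>)\<close> is encoded as the sequence of pairs
  \<open>t \<mapsto> (s\<^sub>t, a\<^sub>t)\<close>.\<close>

definition inf_histories :: "('s, 'a) mdp \<Rightarrow> (nat \<Rightarrow> 's \<times> 'a) set" where
  "inf_histories M = {\<omega>. fst (\<omega> 0) = init M \<and>
     (\<forall>t. snd (\<omega> t) \<in> acts M (fst (\<omega> t)) \<and>
        pmf (kernel M (fst (\<omega> t)) (snd (\<omega> t))) (fst (\<omega> (Suc t))) > 0)}"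

definition cylinder :: "('s, 'a) mdp \<Rightarrow> ('s, 'a) hist \<Rightarrow> (nat \<Rightarrow> 's \<times> 'a) set" where
  "cylinder M h = {\<omega>\<in>inf_histories M. (map \<omega> [0..<hstep h], fst (\<omega> (hstep h))) = h}"

text \<open>\<open>extend_measure\<close> is the null measure when no extension exists. Here one exists
  (Ionescu-Tulcea), and it is unique because the intersection of two cylinders is a cylinder
  or empty.\<close>

definition path_measure ::
    "('s, 'a) mdp \<Rightarrow> ('s, 'a) policy \<Rightarrow> (nat \<Rightarrow> 's \<times> 'a) measure" where
  "path_measure M \<pi> = extend_measure (inf_histories M) (\<Union>t. histories M t) (cylinder M)
     (\<lambda>h. ennreal (hist_prob M \<pi> h))"

definition inft :: "(nat \<Rightarrow> 's \<times> 'a) \<Rightarrow> ('s \<times> 'a) set" where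
  "inft \<omega> = {p. \<exists>\<^sub>\<infinity>t. \<omega> t = p}"

datatype idx = First | Second

type_synonym ('s, 'a) mmdp = "idx \<Rightarrow> ('s, 'a) mdp"

definition binary_mmdp :: "('s, 'a) mmdp \<Rightarrow> bool" where
  "binary_mmdp M \<longleftrightarrow> (\<forall>i. is_mdp (M i)) \<and>
     states (M First) = states (M Second) \<and>
     (\<forall>s\<in>states (M First). acts (M First) s = acts (M Second) s) \<and>
     init (M First) = init (M Second)"

definition mmdp_histories :: "('s, 'a) mmdp \<Rightarrow> nat \<Rightarrow> ('s, 'a) hist set" where
  "mmdp_histories M t = histories (M First) t \<union> histories (M Second) t"

definition is_policy :: "('s, 'a) mmdp \<Rightarrow> ('s, 'a) policy \<Rightarrow> bool" where
  "is_policy M \<pi> \<longleftrightarrow>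
     (\<forall>t. \<forall>h\<in>mmdp_histories M t. set_pmf (\<pi> h) \<subseteq> acts (M First) (hstate h t))"

definition P_error ::
    "('s, 'a) mmdp \<Rightarrow> ('s, 'a) policy \<Rightarrow> nat \<Rightarrow> real \<Rightarrow> real \<Rightarrow> real" where
  "P_error M \<pi> t q \<theta> =
     \<theta> * (\<Sum>h | h \<in> mmdp_histories M t \<and>
              q * hist_prob (M First) \<pi> h \<le> (1 - q) * hist_prob (M Second) \<pi> h.
            hist_prob (M First) \<pi> h) +
     (1 - \<theta>) * (\<Sum>h | h \<in> mmdp_histories M t \<and>
              q * hist_prob (M First) \<pi> h \<ge> (1 - q) * hist_prob (M Second) \<pi> h.
            hist_prob (M Second) \<pi> h)"

definition achieves_APD :: "('s, 'a) mmdp \<Rightarrow> ('s, 'a) policy \<Rightarrow> bool" where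
  "achieves_APD M \<pi> \<longleftrightarrow>
     (\<forall>q\<in>{0<..<1}. \<forall>\<theta>\<in>{0<..<1}. (\<lambda>t. P_error M \<pi> t q \<theta>) \<longlonglongrightarrow> 0)"

definition common_supp :: "('s, 'a) mmdp \<Rightarrow> 's \<Rightarrow> 'a \<Rightarrow> 's set" where
  "common_supp M s a = set_pmf (kernel (M First) s a) \<inter> set_pmf (kernel (M Second) s a)"

definition revealing_pair :: "('s, 'a) mmdp \<Rightarrow> 's \<Rightarrow> 'a \<Rightarrow> bool" where
  "revealing_pair M s a \<longleftrightarrow> common_supp M s a = {}"

definition informative_pair :: "('s, 'a) mmdp \<Rightarrow> 's \<Rightarrow> 'a \<Rightarrow> bool" where
  "informative_pair M s a \<longleftrightarrow>
     kernel (M First) s a \<noteq> kernel (M Second) s a \<and> common_supp M s a \<noteq> {}"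

definition revealing_state :: "('s, 'a) mmdp \<Rightarrow> 's \<Rightarrow> bool" where
  "revealing_state M s \<longleftrightarrow> (\<exists>a\<in>acts (M First) s. revealing_pair M s a)"

definition ISA :: "('s, 'a) mmdp \<Rightarrow> ('s \<times> 'a) set" where
  "ISA M = {(s, a). s \<in> states (M First) \<and> a \<in> acts (M First) s \<and> informative_pair M s a}"

definition identity_revealing :: "('s, 'a) mmdp \<Rightarrow> 's \<Rightarrow> 'a \<Rightarrow> 's \<Rightarrow> bool" where
  "identity_revealing M s a s' \<longleftrightarrow>
     (pmf (kernel (M First) s a) s' > 0) \<noteq> (pmf (kernel (M Second) s a) s' > 0)"

text \<open>\<open>Bot j\<close> is the new state \<open>\<bottom>\<^sub>j\<close>; at the level of actions it is its only action.\<close>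

datatype 'x with_bot = Base 'x | Bot idx

text \<open>\<open>c\<close> selects the revealing action that is retained in each revealing state.\<close>

definition retained_choice :: "('s, 'a) mmdp \<Rightarrow> ('s \<Rightarrow> 'a) \<Rightarrow> bool" where
  "retained_choice M c \<longleftrightarrow>
     (\<forall>s\<in>states (M First). revealing_state M s \<longrightarrow>
        c s \<in> acts (M First) s \<and> revealing_pair M s (c s))"

definition pre_acts :: "('s, 'a) mmdp \<Rightarrow> ('s \<Rightarrow> 'a) \<Rightarrow> 's with_bot \<Rightarrow> 'a with_bot set" where
  "pre_acts M c x = (case x of
       Base s \<Rightarrow> if revealing_state M s then {Base (c s)} else Base ` acts (M First) s
     | Bot j \<Rightarrow> {Bot j})"

text \<open>For an informative pair the kernel is the image of the original one under the map sending
  every successor outside the common support to \<open>\<bottom>\<^sub>i\<close>; see \<open>pmf_pre_kernel_informative\<close> below.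
  The value at \<open>(Base s, Bot j)\<close> is irrelevant, since that action is not available.\<close>

fun pre_kernel ::
    "('s, 'a) mmdp \<Rightarrow> idx \<Rightarrow> 's with_bot \<Rightarrow> 'a with_bot \<Rightarrow> 's with_bot pmf" where
  "pre_kernel M i (Base s) (Base a) =
     (if revealing_state M s then return_pmf (Bot i)
      else if informative_pair M s a then
        map_pmf (\<lambda>s'. if s' \<in> common_supp M s a then Base s' else Bot i) (kernel (M i) s a)
      else map_pmf Base (kernel (M i) s a))"
| "pre_kernel M i (Base s) (Bot j) = return_pmf (Base s)"
| "pre_kernel M i (Bot j) u = return_pmf (Bot j)"

definition preprocessed ::
    "('s, 'a) mmdp \<Rightarrow> ('s \<Rightarrow> 'a) \<Rightarrow> ('s with_bot, 'a with_bot) mmdp" where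
  "preprocessed M c i =
     \<lparr>states = Base ` states (M First) \<union> {Bot First, Bot Second},
      acts = pre_acts M c,
      kernel = pre_kernel M i,
      init = Base (init (M First))\<rparr>"

definition ISAp :: "('s, 'a) mmdp \<Rightarrow> ('s with_bot \<times> 'a with_bot) set" where
  "ISAp M = map_prod Base Base ` ISA M \<union> {(Bot First, Bot First), (Bot Second, Bot Second)}"

definition mix_pmf :: "real \<Rightarrow> 'x pmf \<Rightarrow> 'x pmf \<Rightarrow> 'x pmf" where
  "mix_pmf \<gamma> p q = bind_pmf (bernoulli_pmf \<gamma>) (\<lambda>b. if b then p else q)"

definition informative_mdp :: "('s, 'a) mmdp \<Rightarrow> real \<Rightarrow> ('s, 'a) mdp" where
  "informative_mdp M \<gamma> =
     \<lparr>states = states (M First),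
      acts = acts (M First),
      kernel = (\<lambda>s a. mix_pmf \<gamma> (kernel (M First) s a) (kernel (M Second) s a)),
      init = init (M First)\<rparr>"

lemma pmf_mix_pmf:
  assumes "\<gamma> \<in> {0..1}"
  shows "pmf (mix_pmf \<gamma> p q) x = \<gamma> * pmf p x + (1 - \<gamma>) * pmf q x"
  using assms by (simp add: mix_pmf_def pmf_bind)

lemma pmf_pre_kernel_informative:
  assumes "\<not> revealing_state M s" "informative_pair M s a"
  shows "pmf (pre_kernel M i (Base s) (Base a)) (Base s') =
           (if s' \<in> common_supp M s a then pmf (kernel (M i) s a) s' else 0)"
    and "finite (set_pmf (kernel (M i) s a)) \<Longrightarrow>
         pmf (pre_kernel M i (Base s) (Base a)) (Bot i) =
           (\<Sum>s'\<in>set_pmf (kernel (M i) s a) - common_supp M s a. pmf (kernel (M i) s a) s')"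
    and "j \<noteq> i \<Longrightarrow> pmf (pre_kernel M i (Base s) (Base a)) (Bot j) = 0"
proof -
  let ?p = "kernel (M i) s a" and ?C = "common_supp M s a"
  let ?f = "\<lambda>s'. if s' \<in> ?C then Base s' else Bot i"
  have k: "pre_kernel M i (Base s) (Base a) = map_pmf ?f ?p"
    using assms by simp
  have "?f -` {Base s'} = (if s' \<in> ?C then {s'} else {})"
    by (auto split: if_splits)
  then show "pmf (pre_kernel M i (Base s) (Base a)) (Base s') =
      (if s' \<in> ?C then pmf ?p s' else 0)"
    unfolding k by (simp add: pmf_map pmf.rep_eq)
  have b: "?f -` {Bot i} = - ?C"
    by (auto split: if_splits)
  show "pmf (pre_kernel M i (Base s) (Base a)) (Bot i) =
      (\<Sum>s'\<in>set_pmf ?p - ?C. pmf ?p s')" if "finite (set_pmf ?p)"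
  proof -
    have "measure (measure_pmf ?p) (- ?C) = measure (measure_pmf ?p) (set_pmf ?p - ?C)"
      by (rule measure_eq_AE) (auto simp: AE_measure_pmf_iff)
    also have "\<dots> = (\<Sum>s'\<in>set_pmf ?p - ?C. pmf ?p s')"
      using that by (intro measure_measure_pmf_finite) auto
    finally show ?thesis
      unfolding k pmf_map b .
  qed
  show "pmf (pre_kernel M i (Base s) (Base a)) (Bot j) = 0" if "j \<noteq> i"
    using that unfolding k by (auto simp: pmf_eq_0_set_pmf split: if_splits)
qed

definition base_hist :: "('s, 'a) hist \<Rightarrow> ('s with_bot, 'a with_bot) hist" where
  "base_hist h = (map (map_prod Base Base) (fst h), Base (snd h))"

definition no_identity_revealing :: "('s, 'a) mmdp \<Rightarrow> ('s, 'a) hist \<Rightarrow> bool" where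
  "no_identity_revealing M h \<longleftrightarrow>
     (\<forall>\<tau><hstep h. \<not> identity_revealing M (hstate h \<tau>) (haction h \<tau>) (hstate h (Suc \<tau>)))"

text \<open>The policy \<open>\<pi>'\<close> plays as \<open>\<pi>\<close> does until an identity-revealing transition
  occurs, and arbitrarily afterwards. A history in which a non-retained action was played in a
  revealing state is not a history of the preprocessed MMDP, so \<open>\<pi>\<close> prescribes nothing there.\<close>

definition used_on ::
    "('s, 'a) mmdp \<Rightarrow> ('s \<Rightarrow> 'a) \<Rightarrow> ('s with_bot, 'a with_bot) policy \<Rightarrow> ('s, 'a) policy \<Rightarrow> bool" where
  "used_on M c \<pi> \<pi>' \<longleftrightarrow> is_policy M \<pi>' \<and>
     (\<forall>t. \<forall>h\<in>mmdp_histories M t.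
        no_identity_revealing M h \<and> base_hist h \<in> mmdp_histories (preprocessed M c) t \<longrightarrow>
        map_pmf Base (\<pi>' h) = \<pi> (base_hist h))"

end

theory Submission
  imports Defs
begin

text \<open>
  Why the theorem is true. Up to constants depending on \<open>q\<close> and \<open>\<theta>\<close>, the error probability of the
  maximum a posteriori rule is the overlap \<open>\<Sum>\<^sub>h min (P\<^sub>1 h) (P\<^sub>2 h)\<close> of the two laws on step-\<open>t\<close> histories
  (\<open>achieves_APD_iff_overlap\<close>), so APD says that the overlap tends to \<open>0\<close>. Only histories with
  positive probability in both models contribute to it. Along such a history no identity-revealing
  transition occurs, hence it is also a history of the preprocessed MMDP and has the same probabilities there
  (\<open>sum_overlap_eq\<close>); the overlap may therefore be computed in the preprocessed MMDP, whose
  histories are exactly those of the informative MDP.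

  If pairs of \<open>ISAp\<close> recur almost surely, the overlap vanishes. For the square root of
  \<open>P\<^sub>1 h \<cdot> P\<^sub>2 h\<close>, one step at a pair multiplies the total by the Bhattacharyya coefficient of the two
  successor distributions. It is at most \<open>1\<close> always, and at most a uniform \<open>r < 1\<close> at informative
  pairs; after a visit to some \<open>\<bottom>\<^sub>j\<close> the square root is \<open>0\<close>. Hence dividing it by \<open>r\<close> to the number
  of visits to \<open>ISAp\<close> gives a supermartingale (\<open>discounted_fidelity_le_1\<close>), and histories with at
  least \<open>k\<close> visits carry overlap at most \<open>r\<^sup>k\<close>. For the others, the weighted inequality of the
  arithmetic and geometric means bounds the minimum by the probability in the informative MDP
  (\<open>overlap_le_informative\<close>), and the event of fewer than \<open>k\<close> visits has probability tending to \<open>0\<close>.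

  Conversely, consider the event that \<open>ISAp\<close> is avoided from time \<open>T\<close> on. On it the trajectory never
  enters \<open>\<bottom>\<^sub>j\<close>, and from time \<open>T\<close> on both models and their mixture move with the same kernel. During
  the first \<open>T\<close> steps the ratio of each likelihood to that of the mixture shrinks by at most a
  factor \<open>d\<close> per step, where \<open>d > 0\<close> is a lower bound for the positive transition probabilities of
  the two models. So the overlap is at least \<open>d\<^sup>T\<close> times the probability of that event at every
  time \<open>t \<ge> T\<close> (\<open>hist_prob_ge_informative\<close>). If the overlap tends to \<open>0\<close>, all these events are null, and almost surely \<open>ISAp\<close> is visited infinitely often.

  The law of the infinite trajectory has to be constructed for these statements to have content,
  because \<open>path_measure\<close> is null unless the cylinder probabilities extend to a measure
  (\<open>emeasure_path_measure_cylinder\<close>).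
\<close>

section \<open>Growing histories by one transition\<close>

text \<open>Histories grow at the right end, whereas the products and indices in their definitions run over all
  positions. Writing every nonempty history as \<open>extend h a s'\<close> turns those into recursions.\<close>

definition extend :: "('s, 'a) hist \<Rightarrow> 'a \<Rightarrow> 's \<Rightarrow> ('s, 'a) hist" where
  "extend h a s' = (fst h @ [(snd h, a)], s')"

lemma hist_cases [case_names Init Extend]:
  obtains s where "h = ([], s)" | h' a s' where "h = extend h' a s'"
proof (cases "fst h" rule: rev_cases)
  case Nil
  then show ?thesis using that(1)[of "snd h"] by (cases h) auto
next
  case (snoc ys y)
  then show ?thesis using that(2)[of "(ys, fst y)" "snd y" "snd h"]
    by (cases h, cases y) (auto simp: extend_def)
qed

lemma extend_eq_iff [simp]: "extend h a s = extend h' a' s' \<longleftrightarrow> h = h' \<and> a = a' \<and> s = s'"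
  by (cases h, cases h') (auto simp: extend_def)

lemma snd_extend [simp]: "snd (extend h a s) = s"
  and fst_extend [simp]: "fst (extend h a s) = fst h @ [(snd h, a)]"
  by (simp_all add: extend_def)

lemma hstep_extend [simp]: "hstep (extend h a s) = Suc (hstep h)"
  and hstep_Nil [simp]: "hstep ([], s) = 0"
  by (simp_all add: extend_def hstep_def)

lemma hstate_hstep [simp]: "hstate h (hstep h) = snd h"
  by (simp add: hstate_def hstep_def nth_append)

lemma hprefix_hstep [simp]: "hprefix h (hstep h) = h"
  by (cases h) (simp add: hprefix_def, simp add: hstep_def)

lemma hstate_extend: "\<tau> \<le> hstep h \<Longrightarrow> hstate (extend h a s) \<tau> = hstate h \<tau>"
  by (simp add: hstate_def hstep_def nth_append)

lemma hstate_extend_last [simp]: "hstate (extend h a s) (Suc (hstep h)) = s"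
  by (metis hstate_hstep hstep_extend snd_extend)

lemma haction_extend: "\<tau> < hstep h \<Longrightarrow> haction (extend h a s) \<tau> = haction h \<tau>"
  and haction_extend_last [simp]: "haction (extend h a s) (hstep h) = a"
  by (simp_all add: haction_def hstep_def nth_append)

lemma hprefix_extend: "\<tau> \<le> hstep h \<Longrightarrow> hprefix (extend h a s) \<tau> = hprefix h \<tau>"
  by (simp add: hprefix_def hstate_extend) (simp add: hstep_def)

lemma hstate_Nil [simp]: "hstate ([], s) 0 = s"
  by (simp add: hstate_def)

lemma hstep_histories: "h \<in> histories N t \<Longrightarrow> hstep h = t"
  by (simp add: histories_def)

lemma Nil_in_histories_iff [simp]: "([], s) \<in> histories N t \<longleftrightarrow> t = 0 \<and> s = init N"
  by (auto simp: histories_def)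

lemma extend_in_histories_iff:
  "extend h a s' \<in> histories N (Suc t) \<longleftrightarrow>
     h \<in> histories N t \<and> a \<in> acts N (snd h) \<and> s' \<in> set_pmf (kernel N (snd h) a)"
proof -
  have "extend h a s' \<in> histories N (Suc t) \<longleftrightarrow> hstep h = t \<and>
      hstate h 0 = init N \<and> (\<forall>\<tau><t. haction h \<tau> \<in> acts N (hstate h \<tau>) \<and>
        pmf (kernel N (hstate h \<tau>) (haction h \<tau>)) (hstate h (Suc \<tau>)) > 0) \<and>
      a \<in> acts N (snd h) \<and> pmf (kernel N (snd h) a) s' > 0"
    by (auto simp: histories_def less_Suc_eq hstate_extend haction_extend)
  then show ?thesis by (auto simp: histories_def set_pmf_iff pmf_pos)
qed

lemma histories_0: "histories N 0 = {([], init N)}"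
  by (auto simp: histories_def hstep_def)

lemma histories_Suc_cases:
  assumes "g \<in> histories N (Suc t)"
  obtains h a s' where "g = extend h a s'" "h \<in> histories N t" "a \<in> acts N (snd h)"
    "s' \<in> set_pmf (kernel N (snd h) a)"
proof (cases g rule: hist_cases)
  case (Init s)
  then show ?thesis using assms by simp
next
  case (Extend h a s')
  then show ?thesis using assms that by (simp add: extend_in_histories_iff)
qed

lemma hist_prob_Nil [simp]: "hist_prob N \<pi> ([], s) = (if s = init N then 1 else 0)"
  by (simp add: hist_prob_def)

lemma hist_prob_extend:
  "hist_prob N \<pi> (extend h a s') =
     hist_prob N \<pi> h * (pmf (\<pi> h) a * pmf (kernel N (snd h) a) s')"
  by (simp add: hist_prob_def hstate_extend haction_extend hprefix_extend)

lemma hist_prob_nonneg [simp]: "hist_prob N \<pi> h \<ge> 0"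
  by (auto simp: hist_prob_def intro!: prod_nonneg)

lemma is_mdpD:
  assumes "is_mdp N"
  shows "finite (states N)" "init N \<in> states N"
    and "s \<in> states N \<Longrightarrow> finite (acts N s)" "s \<in> states N \<Longrightarrow> acts N s \<noteq> {}"
    and "s \<in> states N \<Longrightarrow> a \<in> acts N s \<Longrightarrow> set_pmf (kernel N s a) \<subseteq> states N"
  using assms by (auto simp: is_mdp_def)

lemma snd_histories_states:
  assumes "is_mdp N" "h \<in> histories N t"
  shows "snd h \<in> states N"
  using assms(2)
proof (induction t arbitrary: h)
  case 0
  then show ?case using assms(1) by (auto simp: histories_0 is_mdp_def)
next
  case (Suc t)
  from Suc.prems show ?case
  proof (cases rule: histories_Suc_cases)
    case (1 h' a s')
    then show ?thesis using is_mdpD(5)[OF assms(1) Suc.IH[OF 1(2)] 1(3)] by auto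
  qed
qed

lemma histories_Suc:
  "histories N (Suc t) = (\<lambda>(h, a, s'). extend h a s') `
     (SIGMA h:histories N t. SIGMA a:acts N (snd h). set_pmf (kernel N (snd h) a))"
  by (force simp: extend_in_histories_iff elim!: histories_Suc_cases)

lemma finite_kernel:
  "is_mdp N \<Longrightarrow> s \<in> states N \<Longrightarrow> a \<in> acts N s \<Longrightarrow> finite (set_pmf (kernel N s a))"
  by (meson finite_subset is_mdp_def)

lemma finite_histories:
  assumes "is_mdp N"
  shows "finite (histories N t)"
proof (induction t)
  case 0
  then show ?case by (simp add: histories_0)
next
  case (Suc t)
  show ?case unfolding histories_Suc
    using Suc assms snd_histories_states[OF assms]
    by (intro finite_imageI finite_SigmaI) (auto intro: finite_kernel is_mdpD)
qed

lemma sum_histories_Suc: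
  fixes f :: "_ \<Rightarrow> 'b::comm_monoid_add"
  assumes "is_mdp N"
  shows "sum f (histories N (Suc t)) =
    (\<Sum>h\<in>histories N t. \<Sum>a\<in>acts N (snd h). \<Sum>s'\<in>set_pmf (kernel N (snd h) a). f (extend h a s'))"
proof -
  note fin = finite_histories[OF assms] is_mdpD(3)[OF assms] finite_kernel[OF assms]
    snd_histories_states[OF assms]
  have inj: "inj_on (\<lambda>(h, a, s'). extend h a s') A" for A :: "(_ \<times> _ \<times> _) set"
    by (auto simp: inj_on_def)
  show ?thesis
    unfolding histories_Suc
    by (subst sum.reindex[OF inj]) (simp add: sum.Sigma fin comp_def case_prod_unfold finite_SigmaI)
qed

locale mdp_policy =
  fixes N :: "('s, 'a) mdp" and \<pi> :: "('s, 'a) policy"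
  assumes mdp: "is_mdp N"
    and policy: "h \<in> histories N t \<Longrightarrow> set_pmf (\<pi> h) \<subseteq> acts N (snd h)"
begin

text \<open>A history of positive probability can only use actions that the policy plays, and these are
  available, inductively because the shorter history is possible.\<close>

lemma in_histories_if_hist_prob_pos:
  "hist_prob N \<pi> h > 0 \<Longrightarrow> h \<in> histories N (hstep h)"
proof (induction "hstep h" arbitrary: h)
  case 0
  then show ?case by (cases h rule: hist_cases) (auto split: if_splits)
next
  case (Suc t)
  then obtain h' a s' where h: "h = extend h' a s'"
    by (cases h rule: hist_cases) auto
  with Suc.prems have pos: "hist_prob N \<pi> h' > 0" "pmf (\<pi> h') a > 0" "pmf (kernel N (snd h') a) s' > 0"
    by (auto simp: hist_prob_extend zero_less_mult_iff less_le)
  have "h' \<in> histories N (hstep h')" using Suc.hyps pos(1) h by simp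
  moreover have "a \<in> acts N (snd h')"
    using policy[OF \<open>h' \<in> _\<close>] pos(2) by (auto simp: set_pmf_iff)
  ultimately show ?case using pos(3) h by (simp add: extend_in_histories_iff set_pmf_iff)
qed

lemma sum_policy: "h \<in> histories N t \<Longrightarrow> (\<Sum>a\<in>acts N (snd h). pmf (\<pi> h) a) = 1"
  using policy is_mdpD(3)[OF mdp] snd_histories_states[OF mdp] by (intro sum_pmf_eq_1) auto

end

section \<open>The law of the infinite trajectory\<close>

definition prefix_hist :: "(nat \<Rightarrow> 's \<times> 'a) \<Rightarrow> nat \<Rightarrow> ('s, 'a) hist" where
  "prefix_hist \<omega> t = (map \<omega> [0..<t], fst (\<omega> t))"

lemma prefix_hist_0: "prefix_hist \<omega> 0 = ([], fst (\<omega> 0))"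
  and prefix_hist_Suc:
    "prefix_hist \<omega> (Suc t) = extend (prefix_hist \<omega> t) (snd (\<omega> t)) (fst (\<omega> (Suc t)))"
  and hstep_prefix_hist [simp]: "hstep (prefix_hist \<omega> t) = t"
  and snd_prefix_hist [simp]: "snd (prefix_hist \<omega> t) = fst (\<omega> t)"
  by (simp_all add: prefix_hist_def extend_def hstep_def)

text \<open>All conditions on an infinite history are local, so they can be read off its finite prefixes.\<close>

lemma inf_histories_iff:
  "\<omega> \<in> inf_histories N \<longleftrightarrow> (\<forall>t. prefix_hist \<omega> t \<in> histories N t)"
proof
  assume *: "\<omega> \<in> inf_histories N"
  show "\<forall>t. prefix_hist \<omega> t \<in> histories N t"
  proof
    fix t show "prefix_hist \<omega> t \<in> histories N t"
      using * by (induction t)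
        (auto simp: prefix_hist_0 prefix_hist_Suc extend_in_histories_iff inf_histories_def set_pmf_iff less_le)
  qed
next
  assume *: "\<forall>t. prefix_hist \<omega> t \<in> histories N t"
  have "fst (\<omega> 0) = init N" using *[rule_format, of 0] by (simp add: prefix_hist_0)
  moreover have "snd (\<omega> t) \<in> acts N (fst (\<omega> t)) \<and>
      pmf (kernel N (fst (\<omega> t)) (snd (\<omega> t))) (fst (\<omega> (Suc t))) > 0" for t
    using *[rule_format, of "Suc t"] by (simp add: prefix_hist_Suc extend_in_histories_iff pmf_positive)
  ultimately show "\<omega> \<in> inf_histories N" by (simp add: inf_histories_def)
qed

lemma cylinder_eq: "cylinder N h = {\<omega> \<in> inf_histories N. prefix_hist \<omega> (hstep h) = h}"
  by (simp add: cylinder_def prefix_hist_def)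

context mdp_policy
begin

definition pairs :: "('s \<times> 'a) set" where
  "pairs = Sigma (states N) (acts N)"

lemma finite_pairs: "finite pairs"
  using is_mdpD[OF mdp] by (auto simp: pairs_def)

text \<open>An infinite history is a sequence of state-action pairs. Given the pairs so far, the next one arises
  by moving to a successor of the last pair (or to the initial state) and then letting the policy act
  on the history ending in that state.\<close>

definition next_pair :: "('s \<times> 'a) list \<Rightarrow> ('s \<times> 'a) pmf" where
  "next_pair xs = bind_pmf (if xs = [] then return_pmf (init N) else kernel N (fst (last xs)) (snd (last xs)))
     (\<lambda>s. map_pmf (Pair s) (\<pi> (xs, s)))"

text \<open>The probability that the trajectory begins with the given pairs. In contrast to \<open>hist_prob\<close>, the
  action in the last state is included.\<close>

definition list_prob :: "('s \<times> 'a) list \<Rightarrow> real" where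
  "list_prob xs = (if xs = [] then 1 else
     hist_prob N \<pi> (butlast xs, fst (last xs)) * pmf (\<pi> (butlast xs, fst (last xs))) (snd (last xs)))"

lemma list_prob_nonneg: "list_prob xs \<ge> 0"
  by (simp add: list_prob_def)

lemma pmf_next_pair:
  "pmf (next_pair xs) (s, a) =
     pmf (if xs = [] then return_pmf (init N) else kernel N (fst (last xs)) (snd (last xs))) s * pmf (\<pi> (xs, s)) a"
proof -
  have "pmf (map_pmf (Pair s') p) (s, a) = (if s' = s then pmf p a else 0)" for s' and p :: "'a pmf"
  proof (cases "s' = s")
    case True
    then show ?thesis by (simp add: pmf_map_inj' inj_def)
  next
    case False
    then have "(s, a) \<notin> set_pmf (map_pmf (Pair s') p)" by auto
    then show ?thesis using False by (simp add: pmf_eq_0_set_pmf)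
  qed
  then have "pmf (next_pair xs) (s, a) =
     measure_pmf.expectation (if xs = [] then return_pmf (init N) else kernel N (fst (last xs)) (snd (last xs)))
       (\<lambda>s'. if s' = s then pmf (\<pi> (xs, s)) a else 0)"
    unfolding next_pair_def pmf_bind by (intro Bochner_Integration.integral_cong) auto
  also have "\<dots> = (\<Sum>s'\<in>{s}. (if s' = s then pmf (\<pi> (xs, s)) a else 0) *
      pmf (if xs = [] then return_pmf (init N) else kernel N (fst (last xs)) (snd (last xs))) s')"
    by (rule integral_measure_pmf_real) (auto split: if_splits)
  finally show ?thesis by simp
qed

lemma list_prob_snoc: "list_prob (xs @ [y]) = list_prob xs * pmf (next_pair xs) y"
proof (cases xs rule: rev_cases)
  case Nil
  then show ?thesis by (cases y) (auto simp: list_prob_def pmf_next_pair)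
next
  case (snoc zs z)
  obtain s a where y: "y = (s, a)" by (cases y)
  have "(xs, s) = extend (zs, fst z) (snd z) s" by (simp add: snoc extend_def)
  then show ?thesis
    using snoc hist_prob_extend[of N \<pi> "(zs, fst z)" "snd z" s]
    by (simp add: y list_prob_def pmf_next_pair butlast_append)
qed

lemma set_next_pair:
  assumes "list_prob xs > 0"
  shows "set_pmf (next_pair xs) \<subseteq> pairs"
proof
  fix y assume "y \<in> set_pmf (next_pair xs)"
  then have "list_prob (xs @ [y]) > 0"
    using assms by (simp add: list_prob_snoc pmf_positive)
  then have "hist_prob N \<pi> (xs, fst y) > 0" and a: "snd y \<in> set_pmf (\<pi> (xs, fst y))"
    by (auto simp: list_prob_def zero_less_mult_iff set_pmf_iff less_le)
  note h = in_histories_if_hist_prob_pos[OF this(1)]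
  show "y \<in> pairs"
    using policy[OF h] a snd_histories_states[OF mdp h] by (cases y) (auto simp: pairs_def)
qed

definition default_pair :: "'s \<times> 'a" where
  "default_pair = (SOME p. p \<in> pairs)"

lemma default_pair: "default_pair \<in> pairs"
proof -
  have "pairs \<noteq> {}" using is_mdpD(2)[OF mdp] is_mdpD(4)[OF mdp] by (auto simp: pairs_def)
  then show ?thesis unfolding default_pair_def by (simp add: some_in_eq)
qed

text \<open>Restricting the pairs to a finite set makes every function on a finite product measurable, whatever
  the types of states and actions. The default value makes this a probability measure also after lists
  of pairs that are not histories; such lists have probability \<open>0\<close>.\<close>

definition pair_kernel :: "nat \<Rightarrow> (nat \<Rightarrow> 's \<times> 'a) \<Rightarrow> ('s \<times> 'a) measure" where
  "pair_kernel n x = distr (measure_pmf (next_pair (map x [0..<n]))) (count_space pairs)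
     (\<lambda>y. if y \<in> pairs then y else default_pair)"

lemma emeasure_pair_kernel:
  assumes "list_prob (map x [0..<n]) > 0" "y \<in> pairs"
  shows "emeasure (pair_kernel n x) {y} = ennreal (pmf (next_pair (map x [0..<n])) y)"
proof -
  have "emeasure (pair_kernel n x) {y} = emeasure (measure_pmf (next_pair (map x [0..<n])))
      ((\<lambda>y. if y \<in> pairs then y else default_pair) -` {y})"
    unfolding pair_kernel_def using assms default_pair by (subst emeasure_distr) auto
  also have "\<dots> = emeasure (measure_pmf (next_pair (map x [0..<n]))) {y}"
    using set_next_pair[OF assms(1)] assms(2) by (intro emeasure_eq_AE) (auto simp: AE_measure_pmf_iff)
  finally show ?thesis by (simp add: emeasure_pmf_single)
qed

lemma PiM_pairs: "finite J \<Longrightarrow> PiM J (\<lambda>_. count_space pairs) = count_space (J \<rightarrow>\<^sub>E pairs)"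
  by (intro count_space_PiM_finite) (simp_all add: finite_pairs countable_finite)

lemma prob_space_pair_kernel: "prob_space (pair_kernel n x)"
  unfolding pair_kernel_def using default_pair
  by (intro prob_space.prob_space_distr measure_pmf.prob_space_axioms) auto

sublocale IT: Ionescu_Tulcea pair_kernel "\<lambda>_. count_space pairs"
proof (rule Ionescu_Tulcea.intro)
  show "pair_kernel n \<in> PiM {0..<n} (\<lambda>_. count_space pairs) \<rightarrow>\<^sub>M subprob_algebra (count_space pairs)" for n
    using prob_space_pair_kernel by (auto simp: PiM_pairs space_subprob_algebra pair_kernel_def
        intro!: prob_space_imp_subprob_space)
qed (rule prob_space_pair_kernel)

text \<open>The finite-dimensional laws of the Ionescu-Tulcea construction are the intended ones. One more
  coordinate multiplies the mass of a point by one conditional probability, because the integral over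
  the preceding coordinates sees a single point.\<close>

lemma emeasure_C_singleton:
  assumes "x \<in> {0..<n} \<rightarrow>\<^sub>E pairs"
  shows "emeasure (IT.C 0 n (\<lambda>_. undefined)) {x} = ennreal (list_prob (map x [0..<n]))"
  using assms
proof (induction n arbitrary: x)
  case 0
  then show ?case by (simp add: list_prob_def PiM_empty)
next
  case (Suc n)
  let ?C = "IT.C 0 n (\<lambda>_. undefined)"
  let ?x = "restrict x {0..<n}"
  have u: "(\<lambda>_. undefined) \<in> space (PiM {0..<0::nat} (\<lambda>_. count_space pairs))"
    by simp
  have sp: "space ?C = ({0..<n} \<rightarrow>\<^sub>E pairs)" "sets ?C = Pow ({0..<n} \<rightarrow>\<^sub>E pairs)"
    using IT.space_C[OF u, of n] IT.sets_C[OF u, of n] by (simp_all add: PiM_pairs)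
  have ne: "({0..<n} \<rightarrow>\<^sub>E pairs) \<noteq> {}"
    using default_pair by (auto simp: PiE_eq_empty_iff)
  have x: "?x \<in> {0..<n} \<rightarrow>\<^sub>E pairs" "x n \<in> pairs"
    using Suc.prems by (auto simp: PiE_iff)
  have xeq: "x = ?x(n := x n)"
    using Suc.prems by (auto simp: PiE_iff extensional_def fun_eq_iff restrict_def)
  have map_x: "map ?x [0..<n] = map x [0..<n]" by simp
  have "emeasure (IT.C 0 (Suc n) (\<lambda>_. undefined)) {x} = (\<integral>\<^sup>+y. emeasure (IT.eP n y) {x} \<partial>?C)"
    using Suc.prems IT.measurable_eP[of n] ne sp
    by (simp, subst emeasure_bind[where N = "PiM {0..<Suc n} (\<lambda>_. count_space pairs)"])
      (auto simp: PiM_pairs measurable_cong_sets[OF IT.sets_C[OF u] refl])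
  also have "\<dots> = (\<integral>\<^sup>+y. emeasure (pair_kernel n ?x) {x n} * indicator {?x} y \<partial>?C)"
  proof (intro nn_integral_cong)
    fix y assume "y \<in> space ?C"
    then have y: "y \<in> {0..<n} \<rightarrow>\<^sub>E pairs" by (simp add: sp)
    have "emeasure (IT.eP n y) {x} = emeasure (pair_kernel n y) ((\<lambda>z. y(n := z)) -` {x} \<inter> pairs)"
      using IT.emeasure_eP[of y n "{x}"] y Suc.prems by (simp add: PiM_pairs)
    also have "(\<lambda>z. y(n := z)) -` {x} \<inter> pairs = (if y = ?x then {x n} else {})"
    proof -
      have "y = ?x" if "y(n := z) = x" for z
        using y by (auto simp: PiE_iff extensional_def fun_eq_iff restrict_def simp flip: that)
      moreover have "z = x n" if "y(n := z) = x" for z using that by auto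
      ultimately show ?thesis using x(2) xeq by auto
    qed
    finally show "emeasure (IT.eP n y) {x} = emeasure (pair_kernel n ?x) {x n} * indicator {?x} y"
      by (cases "y = ?x") (simp_all only: if_True if_False indicator_simps singleton_iff simp_thms
          emeasure_empty mult_1_right mult_zero_right)
  qed
  also have "\<dots> = emeasure (pair_kernel n ?x) {x n} * ennreal (list_prob (map x [0..<n]))"
    using Suc.IH[OF x(1), unfolded map_x] x(1)
    by (subst nn_integral_cmult_indicator) (simp_all only: sp, blast)
  also have "\<dots> = ennreal (list_prob (map x [0..<Suc n]))"
  proof (cases "list_prob (map x [0..<n]) > 0")
    case True
    then show ?thesis
      using emeasure_pair_kernel[of ?x n "x n"] x(2)
      by (simp add: list_prob_snoc map_x ennreal_mult' mult.commute less_imp_le)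
  next
    case False
    then have "list_prob (map x [0..<n]) = 0" using list_prob_nonneg[of "map x [0..<n]"] by simp
    then show ?thesis by (simp add: list_prob_snoc)
  qed
  finally show ?case .
qed

text \<open>The trajectory as a point of the full product space, before it is restricted to the infinite
  histories of the MDP.\<close>

definition traj :: "(nat \<Rightarrow> 's \<times> 'a) measure" where
  "traj = IT.PF.lim"

lemma space_PiM_pairs [simp]: "space (PiM UNIV (\<lambda>_. count_space pairs)) = (UNIV \<rightarrow>\<^sub>E pairs)"
  by (simp add: space_PiM)

lemma space_traj: "space traj = UNIV \<rightarrow>\<^sub>E pairs"
  by (simp add: traj_def)

lemma emeasure_traj_list:
  assumes "set xs \<subseteq> pairs"
  defines "A \<equiv> {\<omega> \<in> space traj. map \<omega> [0..<length xs] = xs}"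
  shows "A \<in> sets traj" "emeasure traj A = ennreal (list_prob xs)"
proof -
  let ?J = "{0..<length xs}"
  let ?x = "\<lambda>i\<in>?J. xs ! i"
  have x: "?x \<in> ?J \<rightarrow>\<^sub>E pairs" using assms(1) by auto
  then have X: "{?x} \<in> sets (PiM ?J (\<lambda>_. count_space pairs))" by (simp add: PiM_pairs)
  have "map ?x [0..<length xs] = map ((!) xs) [0..<length xs]" by (intro map_cong) simp_all
  then have mx: "map ?x [0..<length xs] = xs" by (simp only: map_nth)
  have A: "A = prod_emb UNIV (\<lambda>_. count_space pairs) ?J {?x}"
  proof -
\<comment> \<open>Both sides say that \<open>\<omega>\<close> and \<open>xs\<close> agree at the positions below the length of \<open>xs\<close>.\<close>
    have "map \<omega> [0..<length xs] = xs \<longleftrightarrow> restrict \<omega> ?J = ?x" for \<omega>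
    proof -
      have "map \<omega> [0..<length xs] = xs \<longleftrightarrow> map \<omega> [0..<length xs] = map ?x [0..<length xs]"
        by (simp only: mx)
      also have "\<dots> \<longleftrightarrow> (\<forall>i\<in>?J. \<omega> i = ?x i)" by (simp only: map_eq_conv set_upt)
      also have "\<dots> \<longleftrightarrow> restrict \<omega> ?J = ?x" by (auto simp: restrict_def fun_eq_iff)
      finally show ?thesis .
    qed
    then show ?thesis unfolding A_def prod_emb_def space_traj by (simp only: space_count_space) blast
  qed
  show "A \<in> sets traj" unfolding A traj_def using X by simp
  have "emeasure traj A = emeasure (IT.CI ?J) {?x}"
    unfolding A traj_def by (rule IT.lim[OF _ X]) simp
  also have "\<dots> = emeasure (IT.C 0 (length xs) (\<lambda>_. undefined)) {?x}"
    using x by (subst IT.emeasure_CI[OF subset_refl X]) (simp add: prod_emb_id)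
  also have "\<dots> = ennreal (list_prob xs)" using emeasure_C_singleton[OF x] by (simp add: mx)
  finally show "emeasure traj A = ennreal (list_prob xs)" .
qed

text \<open>A history ends in a state, so its probability is the sum over the action played in that state.\<close>

lemma emeasure_traj_prefix:
  assumes "set (fst h) \<subseteq> pairs" "snd h \<in> states N"
  defines "E \<equiv> {\<omega> \<in> space traj. prefix_hist \<omega> (hstep h) = h}"
  shows "E \<in> sets traj" "emeasure traj E = ennreal (hist_prob N \<pi> h)"
proof -
  let ?A = "\<lambda>a. {\<omega> \<in> space traj. map \<omega> [0..<length (fst h @ [(snd h, a)])] = fst h @ [(snd h, a)]}"
  have ss: "set (fst h @ [(snd h, a)]) \<subseteq> pairs" if "a \<in> acts N (snd h)" for a
    using that assms by (auto simp: pairs_def)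
  have fin: "finite (acts N (snd h))" using is_mdpD(3)[OF mdp assms(2)] .
  have E: "E = (\<Union>a\<in>acts N (snd h). ?A a)"
  proof -
    let ?n = "length (fst h)"
    have "prefix_hist \<omega> (hstep h) = h \<longleftrightarrow>
        (\<exists>a\<in>acts N (snd h). map \<omega> [0..<?n] = fst h \<and> \<omega> ?n = (snd h, a))"
      if "\<omega> \<in> space traj" for \<omega>
    proof -
      obtain s a where sa: "\<omega> ?n = (s, a)" by (cases "\<omega> ?n")
      moreover have "\<omega> ?n \<in> pairs" using that by (auto simp: space_traj PiE_iff)
      ultimately have "a \<in> acts N s" by (simp add: pairs_def)
      then show ?thesis using sa by (auto simp: prefix_hist_def hstep_def prod_eq_iff)
    qed
    moreover have "map \<omega> [0..<length (fst h @ [(snd h, a)])] = fst h @ [(snd h, a)] \<longleftrightarrow>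
        map \<omega> [0..<?n] = fst h \<and> \<omega> ?n = (snd h, a)" for \<omega> :: "nat \<Rightarrow> 's \<times> 'a" and a
      by simp
    ultimately show ?thesis unfolding E_def by blast
  qed
  note sets_A = emeasure_traj_list(1)[OF ss]
  show "E \<in> sets traj" unfolding E by (intro sets.finite_UN fin sets_A)
  have "emeasure traj E = (\<Sum>a\<in>acts N (snd h). emeasure traj (?A a))"
    unfolding E
  proof (intro sum_emeasure[symmetric] fin)
    show "?A ` acts N (snd h) \<subseteq> sets traj" using sets_A by blast
    show "disjoint_family_on ?A (acts N (snd h))" by (auto simp: disjoint_family_on_def)
  qed
  also have "\<dots> = (\<Sum>a\<in>acts N (snd h). ennreal (hist_prob N \<pi> h * pmf (\<pi> h) a))"
    using emeasure_traj_list(2)[OF ss] by (intro sum.cong refl) (simp add: list_prob_def)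
  also have "\<dots> = ennreal (\<Sum>a\<in>acts N (snd h). hist_prob N \<pi> h * pmf (\<pi> h) a)"
    by (simp add: sum_ennreal)
  also have "(\<Sum>a\<in>acts N (snd h). hist_prob N \<pi> h * pmf (\<pi> h) a) = hist_prob N \<pi> h"
  proof (cases "hist_prob N \<pi> h > 0")
    case True
    from sum_policy[OF in_histories_if_hist_prob_pos[OF this]] show ?thesis
      by (simp add: sum_distrib_left[symmetric])
  next
    case False
    then have "hist_prob N \<pi> h = 0" using hist_prob_nonneg[of N \<pi> h] by linarith
    then show ?thesis by simp
  qed
  finally show "emeasure traj E = ennreal (hist_prob N \<pi> h)" .
qed

lemma fst_histories_pairs: "h \<in> histories N t \<Longrightarrow> set (fst h) \<subseteq> pairs"
proof (induction t arbitrary: h)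
  case 0
  then show ?case by (simp add: histories_0)
next
  case (Suc t)
  from Suc.prems show ?case
  proof (cases rule: histories_Suc_cases)
    case (1 h' a s')
    then show ?thesis using Suc.IH[OF 1(2)] snd_histories_states[OF mdp 1(2)] by (auto simp: pairs_def)
  qed
qed

lemma inf_histories_subset: "inf_histories N \<subseteq> space traj"
proof
  fix \<omega> assume *: "\<omega> \<in> inf_histories N"
  have "\<omega> t \<in> pairs" for t
    using *[unfolded inf_histories_iff, rule_format, THEN fst_histories_pairs, of "Suc t"]
    by (simp add: prefix_hist_def)
  then show "\<omega> \<in> space traj" by (simp add: space_traj PiE_iff)
qed

lemma sets_inf_histories: "inf_histories N \<in> sets traj"
proof -
  have "inf_histories N = (\<Inter>t. \<Union>h\<in>histories N t. {\<omega> \<in> space traj. prefix_hist \<omega> (hstep h) = h})"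
    using inf_histories_subset
    by (auto simp: inf_histories_iff hstep_histories subset_iff)
  also have "\<dots> \<in> sets traj"
    by (intro sets.countable_INT' sets.finite_UN finite_histories mdp emeasure_traj_prefix(1)
        fst_histories_pairs snd_histories_states[OF mdp] image_subsetI) simp_all
  finally show ?thesis .
qed

text \<open>The finitely many lists of pairs of each length that are not histories have probability \<open>0\<close>.\<close>

lemma AE_inf_histories: "AE \<omega> in traj. \<omega> \<in> inf_histories N"
  unfolding inf_histories_iff AE_all_countable
proof
  fix t
  let ?H = "{xs. set xs \<subseteq> pairs \<and> length xs = t} \<times> states N - histories N t"
  let ?E = "\<lambda>h. {\<omega> \<in> space traj. prefix_hist \<omega> (hstep h) = h}"
  have fin: "finite ?H" using finite_lists_length_eq[OF finite_pairs, of t] is_mdpD(1)[OF mdp] by simp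
  have null: "?E h \<in> null_sets traj" if "h \<in> ?H" for h
  proof -
    have "\<not> hist_prob N \<pi> h > 0"
      using in_histories_if_hist_prob_pos[of h] that by (auto simp: hstep_def)
    then have "hist_prob N \<pi> h = 0" using hist_prob_nonneg[of N \<pi> h] by linarith
    then show ?thesis using emeasure_traj_prefix[of h] that by (auto simp: null_sets_def)
  qed
  then have "(\<Union>h\<in>?H. ?E h) \<in> null_sets traj"
    using fin by (intro null_sets.finite_UN) auto
  then show "AE \<omega> in traj. prefix_hist \<omega> t \<in> histories N t"
  proof (rule AE_I')
    show "{\<omega> \<in> space traj. prefix_hist \<omega> t \<notin> histories N t} \<subseteq> (\<Union>h\<in>?H. ?E h)"
    proof clarify
      fix \<omega> assume \<omega>: "\<omega> \<in> space traj" "prefix_hist \<omega> t \<notin> histories N t"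
      then have "\<omega> i \<in> pairs" for i by (auto simp: space_traj PiE_iff)
      moreover from this have "fst (\<omega> t) \<in> states N"
        by (metis pairs_def mem_Sigma_iff prod.collapse)
      ultimately show "\<omega> \<in> (\<Union>h\<in>?H. ?E h)"
        using \<omega> by (intro UN_I[of "prefix_hist \<omega> t"]) (auto simp: prefix_hist_def hstep_def)
    qed
  qed
qed

lemma sets_path_measure:
  "sets (path_measure N \<pi>) = sigma_sets (inf_histories N) (cylinder N ` (\<Union>t. histories N t))"
  and space_path_measure: "space (path_measure N \<pi>) = inf_histories N"
proof -
  have "cylinder N ` (\<Union>t. histories N t) \<subseteq> Pow (inf_histories N)"
    by (auto simp: cylinder_eq)
  then show "sets (path_measure N \<pi>) = sigma_sets (inf_histories N) (cylinder N ` (\<Union>t. histories N t))"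
    "space (path_measure N \<pi>) = inf_histories N"
    unfolding path_measure_def by (simp_all add: sets_extend_measure space_extend_measure)
qed

text \<open>\<open>extend_measure\<close> needs a witness. The trajectory law restricted to the infinite histories is one, as
  almost every trajectory is an infinite history.\<close>

lemma emeasure_path_measure_cylinder:
  assumes "h \<in> histories N t"
  shows "emeasure (path_measure N \<pi>) (cylinder N h) = ennreal (hist_prob N \<pi> h)"
proof (rule emeasure_extend_measure[OF path_measure_def, where \<mu>' = "emeasure (restrict_space traj (inf_histories N))"])
  let ?R = "restrict_space traj (inf_histories N)"
  have \<Omega>: "inf_histories N \<inter> space traj = inf_histories N" using inf_histories_subset by auto
  have cyl: "cylinder N h = {\<omega> \<in> space traj. prefix_hist \<omega> (hstep h) = h} \<inter> inf_histories N" for h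
    using inf_histories_subset by (auto simp: cylinder_eq)
  note E = emeasure_traj_prefix[OF fst_histories_pairs snd_histories_states[OF mdp]]
  show eq: "emeasure ?R (cylinder N h) = ennreal (hist_prob N \<pi> h)" if "h \<in> (\<Union>t. histories N t)" for h
  proof -
    from that obtain t where h: "h \<in> histories N t" by auto
    have "emeasure ?R (cylinder N h) = emeasure traj (cylinder N h)"
      using sets_inf_histories by (intro emeasure_restrict_space) (simp_all only: \<Omega>, auto simp: cylinder_eq)
    also have "\<dots> = emeasure traj {\<omega> \<in> space traj. prefix_hist \<omega> (hstep h) = h}"
      unfolding cyl using AE_inf_histories E(1)[OF h h] sets_inf_histories
      by (intro emeasure_eq_AE) auto
    finally show ?thesis using E(2)[OF h h] by simp
  qed
  have "cylinder N h \<in> sets ?R" if "h \<in> histories N t" for h t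
    using E(1)[OF that that] unfolding cyl by (auto simp: sets_restrict_space image_iff Int_commute)
  then have sub: "sets (path_measure N \<pi>) \<subseteq> sets ?R"
    unfolding sets_path_measure
    using sets.sigma_sets_subset[of "cylinder N ` (\<Union>t. histories N t)" ?R]
    unfolding space_restrict_space \<Omega> by blast
  show "positive (sets (path_measure N \<pi>)) (emeasure ?R)" by (simp add: positive_def)
  show "countably_additive (sets (path_measure N \<pi>)) (emeasure ?R)"
    using emeasure_countably_additive[of ?R] sub by (auto simp: countably_additive_def)
qed (use assms in \<open>auto simp: cylinder_eq\<close>)

lemma sets_cylinder:
  "h \<in> histories N t \<Longrightarrow> cylinder N h \<in> sets (path_measure N \<pi>)"
  unfolding sets_path_measure by (intro sigma_sets.Basic) auto

lemma prefix_event_eq: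
  "{\<omega> \<in> inf_histories N. Q (prefix_hist \<omega> t)} = (\<Union>h\<in>{h \<in> histories N t. Q h}. cylinder N h)"
  by (auto simp: cylinder_eq hstep_histories inf_histories_iff)

lemma sets_prefix_event:
  "{\<omega> \<in> inf_histories N. Q (prefix_hist \<omega> t)} \<in> sets (path_measure N \<pi>)"
  unfolding prefix_event_eq using finite_histories[OF mdp]
  by (intro sets.finite_UN) (auto intro: sets_cylinder)

lemma emeasure_prefix_event:
  "emeasure (path_measure N \<pi>) {\<omega> \<in> inf_histories N. Q (prefix_hist \<omega> t)} =
     ennreal (\<Sum>h | h \<in> histories N t \<and> Q h. hist_prob N \<pi> h)"
proof -
  have "emeasure (path_measure N \<pi>) {\<omega> \<in> inf_histories N. Q (prefix_hist \<omega> t)} =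
      (\<Sum>h\<in>{h \<in> histories N t. Q h}. emeasure (path_measure N \<pi>) (cylinder N h))"
    unfolding prefix_event_eq
  proof (rule sum_emeasure[symmetric])
    show "cylinder N ` {h \<in> histories N t. Q h} \<subseteq> sets (path_measure N \<pi>)"
      using sets_cylinder by blast
    show "disjoint_family_on (cylinder N) {h \<in> histories N t. Q h}"
      by (auto simp: disjoint_family_on_def cylinder_eq hstep_histories)
  qed (use finite_histories[OF mdp] in auto)
  also have "\<dots> = (\<Sum>h\<in>{h \<in> histories N t. Q h}. ennreal (hist_prob N \<pi> h))"
    by (intro sum.cong refl emeasure_path_measure_cylinder) auto
  also have "\<dots> = ennreal (\<Sum>h | h \<in> histories N t \<and> Q h. hist_prob N \<pi> h)"
    by (intro sum_ennreal) simp
  finally show ?thesis .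
qed

lemma prob_space_path_measure: "prob_space (path_measure N \<pi>)"
proof
  show "emeasure (path_measure N \<pi>) (space (path_measure N \<pi>)) = 1"
    using emeasure_prefix_event[of "\<lambda>_. True" 0] by (simp add: space_path_measure histories_0)
qed

lemma measure_prefix_event:
  "measure (path_measure N \<pi>) {\<omega> \<in> inf_histories N. Q (prefix_hist \<omega> t)} =
     (\<Sum>h | h \<in> histories N t \<and> Q h. hist_prob N \<pi> h)"
  by (simp add: measure_def emeasure_prefix_event sum_nonneg)

end

section \<open>Detection error and overlap of likelihoods\<close>

text \<open>Summed over all histories of one length, this is one minus the total variation distance of the two
  laws.\<close>

definition overlap :: "('s, 'a) mmdp \<Rightarrow> ('s, 'a) policy \<Rightarrow> ('s, 'a) hist \<Rightarrow> real" where
  "overlap M \<pi> h = min (hist_prob (M First) \<pi> h) (hist_prob (M Second) \<pi> h)"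

lemma overlap_nonneg [simp]: "overlap M \<pi> h \<ge> 0"
  by (simp add: overlap_def)

text \<open>Wherever the rule errs in favour of one model, the likelihood of the true model is at most a constant
  multiple of the other one, hence of the smaller one.\<close>

lemma P_error_le_overlap:
  assumes "finite (mmdp_histories M t)" "q \<in> {0<..<1}" "\<theta> \<in> {0<..<1}"
  shows "P_error M \<pi> t q \<theta> \<le> (1 / q + 1 / (1 - q)) * (\<Sum>h\<in>mmdp_histories M t. overlap M \<pi> h)"
proof -
  define C where "C = 1 / q + 1 / (1 - q)"
  let ?H = "mmdp_histories M t" and ?P1 = "hist_prob (M First) \<pi>" and ?P2 = "hist_prob (M Second) \<pi>"
  let ?S = "\<Sum>h\<in>?H. overlap M \<pi> h"
  have C: "1 / q \<le> C" "1 / (1 - q) \<le> C" "1 \<le> C"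
    using assms(2) by (auto simp: C_def add_increasing2)
  have dominated: "x \<le> C * min x y"
    if "0 \<le> x" "0 \<le> y" "r * x \<le> (1 - r) * y" "r \<in> {q, 1 - q}" for x y r :: real
  proof -
    have r: "0 < r" "r < 1" "1 / r \<le> C" using that(4) assms(2) C by auto
    have "r * x \<le> y" using that(2,3) r mult_left_le_one_le[of y "1 - r"] by linarith
    then have "x \<le> 1 / r * y" using r by (simp add: field_simps)
    also have "\<dots> \<le> C * y" using r that(2) by (intro mult_right_mono) auto
    finally have "x \<le> C * y" .
    moreover have "x \<le> C * x" using mult_right_mono[OF C(3) that(1)] by simp
    ultimately show ?thesis by (simp add: min_def)
  qed
  have "(\<Sum>h | h \<in> ?H \<and> q * ?P1 h \<le> (1 - q) * ?P2 h. ?P1 h) \<le>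
      (\<Sum>h | h \<in> ?H \<and> q * ?P1 h \<le> (1 - q) * ?P2 h. C * overlap M \<pi> h)"
    unfolding overlap_def by (intro sum_mono dominated[where r = q]) auto
  also have "\<dots> \<le> (\<Sum>h\<in>?H. C * overlap M \<pi> h)"
    using assms(1) C(3) by (intro sum_mono2) auto
  finally have 1: "(\<Sum>h | h \<in> ?H \<and> q * ?P1 h \<le> (1 - q) * ?P2 h. ?P1 h) \<le> C * ?S"
    by (simp add: sum_distrib_left)
  have "(\<Sum>h | h \<in> ?H \<and> q * ?P1 h \<ge> (1 - q) * ?P2 h. ?P2 h) \<le>
      (\<Sum>h | h \<in> ?H \<and> q * ?P1 h \<ge> (1 - q) * ?P2 h. C * overlap M \<pi> h)"
    unfolding overlap_def min.commute[of "?P1 _"]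
    by (intro sum_mono dominated[where r = "1 - q"]) auto
  also have "\<dots> \<le> (\<Sum>h\<in>?H. C * overlap M \<pi> h)"
    using assms(1) C(3) by (intro sum_mono2) auto
  finally have 2: "(\<Sum>h | h \<in> ?H \<and> q * ?P1 h \<ge> (1 - q) * ?P2 h. ?P2 h) \<le> C * ?S"
    by (simp add: sum_distrib_left)
  have "P_error M \<pi> t q \<theta> \<le> \<theta> * (C * ?S) + (1 - \<theta>) * (C * ?S)"
    unfolding P_error_def using 1 2 assms(3) by (intro add_mono mult_left_mono) auto
  also have "\<dots> = C * ?S" by (simp add: algebra_simps)
  finally show ?thesis by (simp only: C_def)
qed

text \<open>For the direction from APD to the overlap the choice \<open>q = \<theta> = 1/2\<close> suffices: the rule then errs by
  half the smaller likelihood, counted twice where both agree.\<close>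

lemma achieves_APD_iff_overlap:
  assumes "\<And>t. finite (mmdp_histories M t)"
  shows "achieves_APD M \<pi> \<longleftrightarrow> (\<lambda>t. \<Sum>h\<in>mmdp_histories M t. overlap M \<pi> h) \<longlonglongrightarrow> 0"
proof
  let ?P1 = "hist_prob (M First) \<pi>" and ?P2 = "hist_prob (M Second) \<pi>"
  assume "achieves_APD M \<pi>"
  then have "(\<lambda>t. P_error M \<pi> t (1/2) (1/2)) \<longlonglongrightarrow> 0"
    unfolding achieves_APD_def by (elim ballE[of _ _ "1/2"]) auto
  then have "(\<lambda>t. 2 * P_error M \<pi> t (1/2) (1/2)) \<longlonglongrightarrow> 0"
    by (rule tendsto_mult_right_zero)
  then show "(\<lambda>t. \<Sum>h\<in>mmdp_histories M t. overlap M \<pi> h) \<longlonglongrightarrow> 0"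
  proof (rule real_tendsto_sandwich[OF _ _ tendsto_const, rotated -1]; intro always_eventually allI)
    fix t
    let ?H = "mmdp_histories M t"
    note fin = assms[of t]
    have "(\<Sum>h\<in>?H. overlap M \<pi> h) \<le> (\<Sum>h\<in>?H. (if ?P1 h \<le> ?P2 h then ?P1 h else 0) + (if ?P1 h \<ge> ?P2 h then ?P2 h else 0))"
      by (intro sum_mono) (auto simp: overlap_def min_def)
    also have "\<dots> = 2 * P_error M \<pi> t (1/2) (1/2)"
      using fin by (simp add: P_error_def sum.distrib sum.inter_filter algebra_simps)
    finally show "(\<Sum>h\<in>?H. overlap M \<pi> h) \<le> 2 * P_error M \<pi> t (1/2) (1/2)" .
  qed (simp add: sum_nonneg)
next
  assume lim: "(\<lambda>t. \<Sum>h\<in>mmdp_histories M t. overlap M \<pi> h) \<longlonglongrightarrow> 0"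
  show "achieves_APD M \<pi>"
    unfolding achieves_APD_def
  proof (intro ballI)
    fix q \<theta> :: real assume q: "q \<in> {0<..<1}" "\<theta> \<in> {0<..<1}"
    show "(\<lambda>t. P_error M \<pi> t q \<theta>) \<longlonglongrightarrow> 0"
    proof (rule real_tendsto_sandwich[OF _ _ tendsto_const])
      show "(\<lambda>t. (1 / q + 1 / (1 - q)) * (\<Sum>h\<in>mmdp_histories M t. overlap M \<pi> h)) \<longlonglongrightarrow> 0"
        using lim by (rule tendsto_mult_right_zero)
      show "\<forall>\<^sub>F t in sequentially. P_error M \<pi> t q \<theta> \<le> (1 / q + 1 / (1 - q)) * (\<Sum>h\<in>mmdp_histories M t. overlap M \<pi> h)"
        using P_error_le_overlap[OF assms q] by simp
      show "\<forall>\<^sub>F t in sequentially. 0 \<le> P_error M \<pi> t q \<theta>"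
        using q by (intro always_eventually allI) (auto simp: P_error_def intro!: add_nonneg_nonneg mult_nonneg_nonneg sum_nonneg)
    qed
  qed
qed

text \<open>The Bhattacharyya coefficient, a sum over the union of the supports since both are finite below.\<close>

definition bhattacharyya :: "'x pmf \<Rightarrow> 'x pmf \<Rightarrow> real" where
  "bhattacharyya p q = (\<Sum>x\<in>set_pmf p \<union> set_pmf q. sqrt (pmf p x * pmf q x))"

text \<open>One minus the squared Hellinger distance. It bounds the coefficient by \<open>1\<close>, and strictly so for
  different distributions.\<close>

lemma bhattacharyya_eq:
  assumes "finite (set_pmf p)" "finite (set_pmf q)"
  shows "2 * bhattacharyya p q =
    2 - (\<Sum>x\<in>set_pmf p \<union> set_pmf q. (sqrt (pmf p x) - sqrt (pmf q x))\<^sup>2)"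
proof -
  have "(\<Sum>x\<in>set_pmf p \<union> set_pmf q. (sqrt (pmf p x) - sqrt (pmf q x))\<^sup>2) =
      (\<Sum>x\<in>set_pmf p \<union> set_pmf q. pmf p x + pmf q x - 2 * sqrt (pmf p x * pmf q x))"
    by (intro sum.cong refl) (simp add: power2_diff real_sqrt_mult)
  also have "\<dots> = 2 - 2 * bhattacharyya p q"
    using assms
    by (simp add: sum_subtractf sum.distrib sum_pmf_eq_1 sum_distrib_left bhattacharyya_def)
  finally show ?thesis by simp
qed

lemma bhattacharyya_le_1:
  "finite (set_pmf p) \<Longrightarrow> finite (set_pmf q) \<Longrightarrow> bhattacharyya p q \<le> 1"
  using bhattacharyya_eq[of p q]
    sum_nonneg[of "set_pmf p \<union> set_pmf q" "\<lambda>x. (sqrt (pmf p x) - sqrt (pmf q x))\<^sup>2"] by simp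

lemma bhattacharyya_less_1:
  assumes "finite (set_pmf p)" "finite (set_pmf q)" "p \<noteq> q"
  shows "bhattacharyya p q < 1"
proof -
  obtain x where x: "pmf p x \<noteq> pmf q x" using \<open>p \<noteq> q\<close> by (metis pmf_eqI)
  then have "x \<in> set_pmf p \<union> set_pmf q" by (auto simp: set_pmf_iff)
  then have "(\<Sum>x\<in>set_pmf p \<union> set_pmf q. (sqrt (pmf p x) - sqrt (pmf q x))\<^sup>2) > 0"
    using x assms(1,2) by (intro sum_pos2[of _ x]) auto
  then show ?thesis using bhattacharyya_eq[OF assms(1,2)] by simp
qed

lemma min_le_powr_mult:
  fixes a b \<gamma> :: real
  assumes "0 \<le> a" "0 \<le> b" "\<gamma> \<in> {0<..<1}"
  shows "min a b \<le> a powr \<gamma> * b powr (1 - \<gamma>)"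
proof -
  have "min a b = min a b powr \<gamma> * min a b powr (1 - \<gamma>)"
    using assms by (simp flip: powr_add)
  also have "\<dots> \<le> a powr \<gamma> * b powr (1 - \<gamma>)"
    using assms by (intro mult_mono powr_mono2) auto
  finally show ?thesis .
qed

lemma Young_nonneg:
  fixes a b \<gamma> :: real
  assumes "0 \<le> a" "0 \<le> b" "\<gamma> \<in> {0<..<1}"
  shows "a powr \<gamma> * b powr (1 - \<gamma>) \<le> \<gamma> * a + (1 - \<gamma>) * b"
  using assms Youngs_inequality_0[of \<gamma> "1 - \<gamma>" a b]
  by (cases "a = 0 \<or> b = 0") (auto simp: less_le)

lemma kernel_informative_mdp:
  "kernel (informative_mdp M \<gamma>) s a = mix_pmf \<gamma> (kernel (M First) s a) (kernel (M Second) s a)"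
  by (simp add: informative_mdp_def)

lemma set_mix_pmf: "\<gamma> \<in> {0<..<1} \<Longrightarrow> set_pmf (mix_pmf \<gamma> p q) = set_pmf p \<union> set_pmf q"
  by (auto simp: mix_pmf_def split: if_splits)

text \<open>The inequality of the weighted arithmetic and geometric means, applied to every transition; the
  policy factors are common to all three laws.\<close>

lemma powr_hist_prob_le_informative:
  assumes "init (M First) = init (M Second)" "\<gamma> \<in> {0<..<1}"
  shows "hist_prob (M First) \<pi> h powr \<gamma> * hist_prob (M Second) \<pi> h powr (1 - \<gamma>) \<le>
    hist_prob (informative_mdp M \<gamma>) \<pi> h"
proof (induction "hstep h" arbitrary: h)
  case 0
  then show ?case using assms
    by (cases h rule: hist_cases) (auto simp: informative_mdp_def)
next
  case (Suc t)
  then obtain h' a s' where h: "h = extend h' a s'"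
    by (cases h rule: hist_cases) auto
  let ?P = "\<lambda>i. hist_prob (M i) \<pi> h'" and ?K = "\<lambda>i. pmf (kernel (M i) (snd h') a) s'"
  let ?p = "pmf (\<pi> h') a"
  have "hist_prob (M First) \<pi> h powr \<gamma> * hist_prob (M Second) \<pi> h powr (1 - \<gamma>) =
      (?P First powr \<gamma> * ?P Second powr (1 - \<gamma>)) * (?p powr \<gamma> * ?p powr (1 - \<gamma>)) *
      (?K First powr \<gamma> * ?K Second powr (1 - \<gamma>))"
    by (simp add: h hist_prob_extend powr_mult)
  also have "?p powr \<gamma> * ?p powr (1 - \<gamma>) = ?p" by (simp flip: powr_add)
  also have "(?P First powr \<gamma> * ?P Second powr (1 - \<gamma>)) * ?p * (?K First powr \<gamma> * ?K Second powr (1 - \<gamma>)) \<le>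
      hist_prob (informative_mdp M \<gamma>) \<pi> h' * ?p * (\<gamma> * ?K First + (1 - \<gamma>) * ?K Second)"
    using Suc.hyps h assms(2) by (intro mult_mono Young_nonneg) auto
  also have "\<dots> = hist_prob (informative_mdp M \<gamma>) \<pi> h"
    using assms(2) by (simp add: h hist_prob_extend kernel_informative_mdp pmf_mix_pmf)
  finally show ?case .
qed

lemma overlap_le_informative:
  assumes "init (M First) = init (M Second)" "\<gamma> \<in> {0<..<1}"
  shows "overlap M \<pi> h \<le> hist_prob (informative_mdp M \<gamma>) \<pi> h"
  using powr_hist_prob_le_informative[of M \<gamma> \<pi> h, OF assms]
    min_le_powr_mult[of "hist_prob (M First) \<pi> h" "hist_prob (M Second) \<pi> h" \<gamma>] assms(2)
  by (simp add: overlap_def)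


section \<open>Visits along a trajectory\<close>

definition visits :: "('s \<times> 'a) set \<Rightarrow> ('s, 'a) hist \<Rightarrow> nat" where
  "visits A h = length (filter (\<lambda>p. p \<in> A) (fst h))"

lemma visits_extend: "visits A (extend h a s') = visits A h + (if (snd h, a) \<in> A then 1 else 0)"
  by (simp add: visits_def)

lemma visits_prefix_Suc:
  "visits A (prefix_hist \<omega> (Suc t)) = visits A (prefix_hist \<omega> t) + (if \<omega> t \<in> A then 1 else 0)"
  by (simp add: prefix_hist_Suc visits_extend)

lemma visits_prefix_mono: "m \<le> n \<Longrightarrow> visits A (prefix_hist \<omega> m) \<le> visits A (prefix_hist \<omega> n)"
  by (induction rule: dec_induct) (auto simp: visits_prefix_Suc)

lemma visits_unbounded:
  assumes "\<exists>\<^sub>\<infinity>t. \<omega> t \<in> A"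
  shows "\<exists>t. visits A (prefix_hist \<omega> t) \<ge> k"
proof (induction k)
  case 0
  then show ?case by simp
next
  case (Suc k)
  then obtain t where t: "visits A (prefix_hist \<omega> t) \<ge> k" by blast
  obtain n where n: "n \<ge> t" "\<omega> n \<in> A" using assms by (auto simp: INFM_nat_le)
  have "visits A (prefix_hist \<omega> (Suc n)) \<ge> Suc k"
    using visits_prefix_mono[OF n(1), of A \<omega>] t n(2) by (simp add: visits_prefix_Suc)
  then show ?case by blast
qed

text \<open>Pigeonhole: if a finite set is visited infinitely often, so is one of its elements.\<close>

lemma inft_Int_nonempty_iff:
  assumes "finite A"
  shows "inft \<omega> \<inter> A \<noteq> {} \<longleftrightarrow> (\<exists>\<^sub>\<infinity>t. \<omega> t \<in> A)"
proof -
  have "(\<exists>\<^sub>\<infinity>t. \<omega> t \<in> A) \<longleftrightarrow> (\<exists>\<^sub>\<infinity>t. \<exists>p\<in>A. \<omega> t = p)" by simp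
  also have "\<dots> \<longleftrightarrow> (\<exists>p\<in>A. \<exists>\<^sub>\<infinity>t. \<omega> t = p)"
    by (rule frequently_bex_finite_distrib[OF assms])
  finally show ?thesis by (auto simp: inft_def)
qed

context mdp_policy
begin

lemma sets_visit: "{\<omega> \<in> inf_histories N. \<omega> t \<in> A} \<in> sets (path_measure N \<pi>)"
proof -
  have "{\<omega> \<in> inf_histories N. \<omega> t \<in> A} =
      {\<omega> \<in> inf_histories N. last (fst (prefix_hist \<omega> (Suc t))) \<in> A}"
    by (simp add: prefix_hist_def)
  then show ?thesis using sets_prefix_event[of "\<lambda>h. last (fst h) \<in> A" "Suc t"] by simp
qed

lemma sets_eventually_avoid:
  "{\<omega> \<in> inf_histories N. \<forall>t\<ge>T. \<omega> t \<notin> A} \<in> sets (path_measure N \<pi>)"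
proof -
  have "{\<omega> \<in> inf_histories N. \<forall>t\<ge>T. \<omega> t \<notin> A} = (\<Inter>t\<in>{T..}. {\<omega> \<in> inf_histories N. \<omega> t \<in> - A})"
    by auto
  also have "\<dots> \<in> sets (path_measure N \<pi>)"
    using sets_visit[of _ "- A"] by (intro sets.countable_INT') auto
  finally show ?thesis .
qed

lemma sets_infinitely_often:
  "{\<omega> \<in> inf_histories N. \<exists>\<^sub>\<infinity>t. \<omega> t \<in> A} \<in> sets (path_measure N \<pi>)"
proof -
  have "{\<omega> \<in> inf_histories N. \<exists>\<^sub>\<infinity>t. \<omega> t \<in> A} =
      space (path_measure N \<pi>) - (\<Union>T. {\<omega> \<in> inf_histories N. \<forall>t\<ge>T. \<omega> t \<notin> A})"
    by (auto simp: INFM_nat_le space_path_measure)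
  also have "\<dots> \<in> sets (path_measure N \<pi>)"
    by (intro sets.Diff sets.top sets.countable_UN image_subsetI sets_eventually_avoid)
  finally show ?thesis .
qed

text \<open>The events of fewer than \<open>k\<close> visits decrease in time, and their intersection misses the almost sure
  event of infinitely many visits.\<close>

lemma few_visits_tendsto_0:
  assumes "measure (path_measure N \<pi>) {\<omega> \<in> inf_histories N. \<exists>\<^sub>\<infinity>t. \<omega> t \<in> A} = 1"
  shows "(\<lambda>t. \<Sum>h | h \<in> histories N t \<and> visits A h < k. hist_prob N \<pi> h) \<longlonglongrightarrow> 0"
proof -
  let ?\<mu> = "path_measure N \<pi>" and ?R = "{\<omega> \<in> inf_histories N. \<exists>\<^sub>\<infinity>t. \<omega> t \<in> A}"
  let ?B = "\<lambda>t. {\<omega> \<in> inf_histories N. visits A (prefix_hist \<omega> t) < k}"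
  interpret P: prob_space ?\<mu> by (rule prob_space_path_measure)
  have "(\<lambda>t. measure ?\<mu> (?B t)) \<longlonglongrightarrow> measure ?\<mu> (\<Inter>t. ?B t)"
  proof (rule P.finite_Lim_measure_decseq)
    show "range ?B \<subseteq> sets ?\<mu>" using sets_prefix_event[of "\<lambda>h. visits A h < k"] by auto
    show "decseq ?B"
      using visits_prefix_mono[of _ _ A] by (auto simp: decseq_def intro: le_less_trans)
  qed
  moreover have "measure ?\<mu> (\<Inter>t. ?B t) = 0"
  proof -
    have "measure ?\<mu> (\<Inter>t. ?B t) \<le> measure ?\<mu> (space ?\<mu> - ?R)"
    proof (rule P.finite_measure_mono)
      show "(\<Inter>t. ?B t) \<subseteq> space ?\<mu> - ?R"
      proof
        fix \<omega> assume "\<omega> \<in> (\<Inter>t. ?B t)"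
        then have "\<omega> \<in> inf_histories N" "\<And>t. visits A (prefix_hist \<omega> t) < k" by auto
        moreover from this(2) have "\<not> (\<exists>\<^sub>\<infinity>t. \<omega> t \<in> A)"
          using visits_unbounded[of \<omega> A k] by (meson not_le)
        ultimately show "\<omega> \<in> space ?\<mu> - ?R" by (simp add: space_path_measure)
      qed
    qed (intro sets.Diff sets.top sets_infinitely_often)
    also have "\<dots> = 0" using P.prob_compl[OF sets_infinitely_often[of A]] assms by simp
    finally show ?thesis using measure_nonneg[of ?\<mu> "\<Inter>t. ?B t"] by linarith
  qed
  ultimately show ?thesis by (simp add: measure_prefix_event[of "\<lambda>h. visits A h < k"])
qed

text \<open>Finitely many visits means avoidance from some time on, a countable union of the given events.\<close>

lemma infinitely_often_AE:
  assumes "\<And>T. measure (path_measure N \<pi>) {\<omega> \<in> inf_histories N. \<forall>t\<ge>T. \<omega> t \<notin> A} = 0"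
  shows "measure (path_measure N \<pi>) {\<omega> \<in> inf_histories N. \<exists>\<^sub>\<infinity>t. \<omega> t \<in> A} = 1"
proof -
  let ?\<mu> = "path_measure N \<pi>" and ?E = "\<lambda>T. {\<omega> \<in> inf_histories N. \<forall>t\<ge>T. \<omega> t \<notin> A}"
  interpret P: prob_space ?\<mu> by (rule prob_space_path_measure)
  have "?E T \<in> null_sets ?\<mu>" for T
    by (intro null_setsI sets_eventually_avoid) (simp only: P.emeasure_eq_measure assms ennreal_0)
  then have "(\<Union>T. ?E T) \<in> null_sets ?\<mu>" by (rule null_sets_UN)
  then have "AE \<omega> in ?\<mu>. \<omega> \<in> {\<omega> \<in> inf_histories N. \<exists>\<^sub>\<infinity>t. \<omega> t \<in> A}"
  proof (rule AE_I')
    show "{\<omega> \<in> space ?\<mu>. \<omega> \<notin> {\<omega> \<in> inf_histories N. \<exists>\<^sub>\<infinity>t. \<omega> t \<in> A}} \<subseteq> (\<Union>T. ?E T)"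
      unfolding space_path_measure INFM_nat_le by blast
  qed
  then show ?thesis using P.prob_eq_1[OF sets_infinitely_often[of A]] by simp
qed

end

section \<open>Kernels and histories of the preprocessed MMDP\<close>

lemma idx_cases: "i = First \<or> i = Second"
  by (cases i) auto

lemma finite_positive_lower_bound:
  fixes X :: "real set"
  assumes "finite X"
  obtains d where "0 < d" "d \<le> 1" "\<And>x. x \<in> X \<Longrightarrow> 0 < x \<Longrightarrow> d \<le> x"
proof -
  have "\<exists>d>0. d \<le> 1 \<and> (\<forall>x\<in>X. 0 < x \<longrightarrow> d \<le> x)"
    using assms
  proof (induction X)
    case empty
    show ?case by (intro exI[of _ 1]) auto
  next
    case (insert x X)
    then obtain d where "0 < d" "d \<le> 1" "\<forall>x\<in>X. 0 < x \<longrightarrow> d \<le> x" by blast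
    then show ?case by (intro exI[of _ "if 0 < x then min d x else d"]) auto
  qed
  then show ?thesis using that by blast
qed

lemma finite_uniform_contraction:
  fixes f :: "'x \<Rightarrow> real"
  assumes "finite S" "\<And>x. x \<in> S \<Longrightarrow> f x < 1"
  obtains r where "0 < r" "r < 1" "\<And>x. x \<in> S \<Longrightarrow> f x \<le> r"
proof -
  have "\<exists>r\<in>{0<..<1}. \<forall>x\<in>S. f x \<le> r"
    using assms
  proof (induction S)
    case empty
    show ?case by (intro bexI[of _ "1/2"]) auto
  next
    case (insert x S)
    then obtain r where "r \<in> {0<..<1}" "\<forall>x\<in>S. f x \<le> r" by auto
    then show ?case using insert.prems[of x] by (intro bexI[of _ "max r (f x)"]) auto
  qed
  then show ?thesis using that by auto
qed

lemma pmf_map_Base: "pmf (map_pmf Base p) (Base x) = pmf p x"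
  by (intro pmf_map_inj') (auto simp: inj_def)

text \<open>Preprocessing moves only mass outside the common support.\<close>

lemma pmf_pre_kernel_common:
  assumes "\<not> revealing_state M s" "s' \<in> common_supp M s a"
  shows "pmf (pre_kernel M i (Base s) (Base a)) (Base s') = pmf (kernel (M i) s a) s'"
proof (cases "informative_pair M s a")
  case True
  then show ?thesis using assms pmf_pre_kernel_informative(1)[of M s a i s'] by simp
next
  case False
  then show ?thesis using assms(1) by (simp add: pmf_map_Base)
qed

lemma kernel_eq_if_not_informative:
  assumes "a \<in> acts (M First) s" "\<not> revealing_state M s" "\<not> informative_pair M s a"
  shows "kernel (M First) s a = kernel (M Second) s a"
  using assms by (auto simp: revealing_state_def revealing_pair_def informative_pair_def)

lemma pre_kernel_eq_if_not_informative:
  assumes "a \<in> acts (M First) s" "\<not> revealing_state M s" "\<not> informative_pair M s a"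
  shows "pre_kernel M First (Base s) (Base a) = pre_kernel M Second (Base s) (Base a)"
  using assms kernel_eq_if_not_informative[OF assms] by simp

text \<open>A transition between original states survives preprocessing only if it is possible in both models,
  and never from a revealing state.\<close>

lemma Base_in_pre_kernel:
  assumes "x \<in> pre_acts M c (Base s)" "Base s' \<in> set_pmf (pre_kernel M i (Base s) x)"
  obtains a where "x = Base a" "a \<in> acts (M First) s" "\<not> revealing_state M s" "s' \<in> common_supp M s a"
proof -
  have nr: "\<not> revealing_state M s"
    using assms by (cases "revealing_state M s") (auto simp: pre_acts_def)
  then obtain a where a: "x = Base a" "a \<in> acts (M First) s"
    using assms(1) by (auto simp: pre_acts_def)
  have "s' \<in> common_supp M s a"
  proof (cases "informative_pair M s a")
    case True
    then show ?thesis using assms(2) nr a by (auto split: if_splits)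
  next
    case False
    from kernel_eq_if_not_informative[OF a(2) nr False] idx_cases[of i]
    show ?thesis using assms(2) nr a False by (auto simp: common_supp_def)
  qed
  then show ?thesis using that a nr by blast
qed

lemma Bot_in_pre_kernel:
  assumes "x \<in> pre_acts M c (Base s)" "Bot j \<in> set_pmf (pre_kernel M i (Base s) x)"
  shows "j = i"
  using assms by (auto simp: pre_acts_def split: if_splits)

text \<open>Redirecting mass to \<open>\<bottom>\<^sub>i\<close> loses no information: if any mass is redirected, \<open>\<bottom>\<^sub>i\<close> itself
  distinguishes the models, and otherwise the kernels are unchanged.\<close>

lemma pre_kernel_neq_if_informative:
  assumes "informative_pair M s a"
  shows "pre_kernel M First (Base s) (Base a) \<noteq> pre_kernel M Second (Base s) (Base a)"
proof (cases "revealing_state M s")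
  case True
  then show ?thesis by simp
next
  case False
  show ?thesis
  proof
    assume eq: "pre_kernel M First (Base s) (Base a) = pre_kernel M Second (Base s) (Base a)"
    have supp: "set_pmf (kernel (M i) s a) \<subseteq> common_supp M s a" for i
    proof
      fix s' assume s': "s' \<in> set_pmf (kernel (M i) s a)"
      show "s' \<in> common_supp M s a"
      proof (rule ccontr)
        assume "s' \<notin> common_supp M s a"
        then have "Bot i \<in> set_pmf (pre_kernel M i (Base s) (Base a))"
          using s' \<open>\<not> revealing_state M s\<close> assms by (force simp: image_iff)
        moreover obtain j where "j \<noteq> i" by (cases i) auto
        ultimately have "Bot i \<in> set_pmf (pre_kernel M j (Base s) (Base a))"
          using eq idx_cases[of i] idx_cases[of j] by (auto simp del: pre_kernel.simps)
        then show False using \<open>\<not> revealing_state M s\<close> assms \<open>j \<noteq> i\<close> by (auto split: if_splits)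
      qed
    qed
    have "pmf (kernel (M First) s a) s' = pmf (kernel (M Second) s a) s'" for s'
    proof (cases "s' \<in> common_supp M s a")
      case True
      then show ?thesis using pmf_pre_kernel_common[OF False True] eq by metis
    next
      case False
      then show ?thesis using supp[of First] supp[of Second] by (metis pmf_eq_0_set_pmf subsetD)
    qed
    then show False using assms by (auto simp: informative_pair_def intro: pmf_eqI)
  qed
qed

lemma finite_ISA:
  assumes "is_mdp (M First)"
  shows "finite (ISA M)"
proof (rule finite_subset)
  show "ISA M \<subseteq> Sigma (states (M First)) (acts (M First))" by (auto simp: ISA_def)
qed (use is_mdpD[OF assms] in auto)

lemma finite_ISAp: "is_mdp (M First) \<Longrightarrow> finite (ISAp M)"
  by (simp add: ISAp_def finite_ISA)

lemma base_hist_Nil [simp]: "base_hist ([], s) = ([], Base s)"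
  by (simp add: base_hist_def)

lemma base_hist_extend [simp]: "base_hist (extend h a s') = extend (base_hist h) (Base a) (Base s')"
  by (simp add: base_hist_def extend_def)

lemma snd_base_hist [simp]: "snd (base_hist h) = Base (snd h)"
  by (simp add: base_hist_def)

lemma hstep_base_hist [simp]: "hstep (base_hist h) = hstep h"
  by (simp add: base_hist_def hstep_def)

lemma inj_base_hist: "inj (base_hist :: ('s, 'a) hist \<Rightarrow> _)"
proof (rule injI)
  fix h h' :: "('s, 'a) hist" assume "base_hist h = base_hist h'"
  moreover have "inj (map_prod Base Base :: 's \<times> 'a \<Rightarrow> _)"
    by (intro prod.inj_map) (auto simp: inj_def)
  ultimately show "h = h'"
    by (simp add: base_hist_def prod_eq_iff inj_map_eq_map)
qed

text \<open>The hypotheses of the theorem that do not concern the policy \<open>\<pi>'\<close> on the original MMDP.\<close>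

locale preprocessed_policy =
  fixes M :: "('s, 'a) mmdp" and c :: "'s \<Rightarrow> 'a" and \<gamma> :: real
    and \<pi> :: "('s with_bot, 'a with_bot) policy"
  assumes M: "binary_mmdp M"
    and c: "retained_choice M c"
    and \<gamma>: "\<gamma> \<in> {0<..<1}"
    and \<pi>: "is_policy (preprocessed M c) \<pi>"
begin

abbreviation Mp :: "('s with_bot, 'a with_bot) mmdp" where
  "Mp \<equiv> preprocessed M c"

abbreviation MI :: "('s with_bot, 'a with_bot) mdp" where
  "MI \<equiv> informative_mdp Mp \<gamma>"

lemma Mp_simps [simp]:
  "states (Mp i) = Base ` states (M First) \<union> {Bot First, Bot Second}"
  "acts (Mp i) = pre_acts M c" "kernel (Mp i) = pre_kernel M i" "init (Mp i) = Base (init (M First))"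
  by (simp_all add: preprocessed_def)

lemma MI_simps [simp]:
  "states MI = Base ` states (M First) \<union> {Bot First, Bot Second}"
  "acts MI = pre_acts M c" "init MI = Base (init (M First))"
  by (simp_all add: informative_mdp_def)

lemma set_kernel_MI:
  "set_pmf (kernel MI s x) = set_pmf (pre_kernel M First s x) \<union> set_pmf (pre_kernel M Second s x)"
  by (simp add: kernel_informative_mdp set_mix_pmf[OF \<gamma>])

lemma pmf_kernel_MI:
  "pmf (kernel MI s x) y = \<gamma> * pmf (pre_kernel M First s x) y + (1 - \<gamma>) * pmf (pre_kernel M Second s x) y"
  using \<gamma> by (simp add: kernel_informative_mdp pmf_mix_pmf)

lemma mdp_M: "is_mdp (M i)"
  and acts_M: "s \<in> states (M First) \<Longrightarrow> acts (M i) s = acts (M First) s"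
  and init_M: "init (M i) = init (M First)"
  using M idx_cases[of i] by (auto simp: binary_mmdp_def)

lemma mdp_Mp: "is_mdp (Mp i)"
proof -
  have "finite (pre_acts M c s) \<and> pre_acts M c s \<noteq> {} \<and>
      (\<forall>x\<in>pre_acts M c s. set_pmf (pre_kernel M i s x) \<subseteq> Base ` states (M First) \<union> {Bot First, Bot Second})"
    if "s \<in> Base ` states (M First) \<union> {Bot First, Bot Second}" for s
  proof (cases s)
    case (Base s0)
    then have s0: "s0 \<in> states (M First)" using that by auto
    have "set_pmf (pre_kernel M i (Base s0) x) \<subseteq> Base ` states (M First) \<union> {Bot First, Bot Second}"
      if x: "x \<in> pre_acts M c (Base s0)" for x
    proof
      fix y assume y: "y \<in> set_pmf (pre_kernel M i (Base s0) x)"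
      show "y \<in> Base ` states (M First) \<union> {Bot First, Bot Second}"
      proof (cases y)
        case (Base s')
        obtain a where "a \<in> acts (M First) s0" "s' \<in> common_supp M s0 a"
          using Base_in_pre_kernel[OF x y[unfolded Base]] .
        then have "s' \<in> states (M First)"
          using is_mdpD(5)[OF mdp_M s0, of a] by (auto simp: common_supp_def)
        then show ?thesis using Base by auto
      next
        case (Bot j)
        then show ?thesis using idx_cases[of j] by auto
      qed
    qed
    then show ?thesis
      using Base is_mdpD(3,4)[OF mdp_M s0] by (auto simp: pre_acts_def)
  next
    case (Bot j)
    then show ?thesis using idx_cases[of j] by (auto simp: pre_acts_def)
  qed
  then show ?thesis using is_mdpD(1,2)[OF mdp_M[of First]] unfolding is_mdp_def by simp
qed

lemma mdp_MI: "is_mdp MI"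
  using mdp_Mp[of First] mdp_Mp[of Second] unfolding is_mdp_def by (simp add: set_kernel_MI)

text \<open>A history of the mixture is either still undecided and possible in both models, or it has been
  absorbed in \<open>\<bottom>\<^sub>j\<close> and rules out the other model. In particular a policy of the preprocessed MMDP is
  defined on all histories of the mixture.\<close>

lemma histories_MI_cases:
  assumes "g \<in> histories MI t"
  obtains (Base) s where "snd g = Base s" "\<And>i. g \<in> histories (Mp i) t"
  | (Bot) j where "snd g = Bot j" "g \<in> histories (Mp j) t" "\<And>i. i \<noteq> j \<Longrightarrow> hist_prob (Mp i) \<pi> g = 0"
proof -
  have "(\<exists>s. snd g = Base s \<and> (\<forall>i. g \<in> histories (Mp i) t)) \<or>
      (\<exists>j. snd g = Bot j \<and> g \<in> histories (Mp j) t \<and> (\<forall>i. i \<noteq> j \<longrightarrow> hist_prob (Mp i) \<pi> g = 0))"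
    using assms
  proof (induction t arbitrary: g)
    case 0
    then show ?case by (simp add: histories_0)
  next
    case (Suc t)
    from Suc.prems show ?case
    proof (cases rule: histories_Suc_cases)
      case (1 h x y)
      then have x: "x \<in> pre_acts M c (snd h)" by simp
      obtain k where y: "y \<in> set_pmf (pre_kernel M k (snd h) x)"
        using 1(4) by (auto simp: set_kernel_MI)
      from Suc.IH[OF 1(2)] consider s where "snd h = Base s" "\<And>i. h \<in> histories (Mp i) t"
        | j where "snd h = Bot j" "h \<in> histories (Mp j) t" "\<And>i. i \<noteq> j \<Longrightarrow> hist_prob (Mp i) \<pi> h = 0"
        by blast
      then show ?thesis
      proof cases
        case s: 1
        show ?thesis
        proof (cases y)
          case (Base s')
          then obtain a where a: "x = Base a" "a \<in> acts (M First) s" "\<not> revealing_state M s"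
            "s' \<in> common_supp M s a"
            using Base_in_pre_kernel[of x M c s s' k] x y s(1) by metis
          have "y \<in> set_pmf (pre_kernel M i (snd h) x)" for i
            using a pmf_pre_kernel_common[OF a(3,4), of i] idx_cases[of i] Base s(1)
            by (auto simp: set_pmf_iff common_supp_def simp del: pre_kernel.simps)
          then show ?thesis using 1 s Base x by (simp add: extend_in_histories_iff)
        next
          case (Bot j)
          have j: "j = i" if "Bot j \<in> set_pmf (pre_kernel M i (snd h) x)" for i
            using Bot_in_pre_kernel[of x M c s j i] that x s(1) by simp
          then have "pmf (pre_kernel M i (snd h) x) (Bot j) = 0" if "i \<noteq> j" for i
            using that by (metis pmf_eq_0_set_pmf)
          moreover have "k = j" using j[of k] y Bot by simp
          ultimately show ?thesis using 1 s Bot x y by (simp add: extend_in_histories_iff hist_prob_extend)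
        qed
      next
        case b: (2 j)
        then have "y = Bot j" using y by simp
        then show ?thesis using 1 b x by (simp add: extend_in_histories_iff hist_prob_extend)
      qed
    qed
  qed
  then show ?thesis using that by blast
qed

lemma policy_MI: "h \<in> histories MI t \<Longrightarrow> set_pmf (\<pi> h) \<subseteq> pre_acts M c (snd h)"
proof -
  assume h: "h \<in> histories MI t"
  then have "h \<in> histories (Mp First) t \<or> h \<in> histories (Mp Second) t"
    by (cases rule: histories_MI_cases) (metis idx_cases)+
  then have "h \<in> mmdp_histories Mp t" by (simp add: mmdp_histories_def)
  then have "set_pmf (\<pi> h) \<subseteq> pre_acts M c (hstate h t)" using \<pi> by (auto simp: is_policy_def)
  moreover have "hstate h t = snd h" using hstep_histories[OF h] hstate_hstep[of h] by simp
  ultimately show ?thesis by simp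
qed

sublocale MI: mdp_policy MI \<pi>
  by unfold_locales (use mdp_MI policy_MI in auto)

abbreviation affinity :: "'s with_bot \<Rightarrow> 'a with_bot \<Rightarrow> real" where
  "affinity s x \<equiv> bhattacharyya (pre_kernel M First s x) (pre_kernel M Second s x)"

lemma finite_pre_kernel:
  "s \<in> states MI \<Longrightarrow> x \<in> pre_acts M c s \<Longrightarrow> finite (set_pmf (pre_kernel M i s x))"
  using finite_kernel[OF mdp_Mp[of i], of s x] by simp

lemma affinity_le_1:
  "s \<in> states MI \<Longrightarrow> x \<in> pre_acts M c s \<Longrightarrow> affinity s x \<le> 1"
  by (intro bhattacharyya_le_1 finite_pre_kernel)

text \<open>The strict inequality for each informative pair becomes uniform because there are finitely many.\<close>

lemma uniform_contraction:
  "\<exists>r. 0 < r \<and> r < 1 \<and>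
    (\<forall>s x. (Base s, x) \<in> ISAp M \<longrightarrow> x \<in> pre_acts M c (Base s) \<longrightarrow> affinity (Base s) x \<le> r)"
proof -
  let ?S = "{(s, x) \<in> map_prod Base Base ` ISA M. x \<in> pre_acts M c s}"
  have "(\<lambda>(s, x). affinity s x) p < 1" if "p \<in> ?S" for p
  proof -
    from that obtain s a where p: "p = (Base s, Base a)" "(s, a) \<in> ISA M" "Base a \<in> pre_acts M c (Base s)"
      by auto
    then have "informative_pair M s a" "Base s \<in> states MI" by (auto simp: ISA_def)
    from bhattacharyya_less_1[OF finite_pre_kernel[OF this(2) p(3)] finite_pre_kernel[OF this(2) p(3)]
        pre_kernel_neq_if_informative[OF this(1)]]
    show ?thesis by (simp only: p(1) prod.case)
  qed
  moreover have "finite ?S" using finite_ISA[of M, OF mdp_M] by (auto intro: finite_subset)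
  ultimately obtain r where "0 < r" "r < 1" "\<And>p. p \<in> ?S \<Longrightarrow> (\<lambda>(s, x). affinity s x) p \<le> r"
    using finite_uniform_contraction[of ?S "\<lambda>(s, x). affinity s x"] by blast
  then show ?thesis by (intro exI[of _ r]) (force simp: ISAp_def)
qed

end

section \<open>The overlap is the same before and after preprocessing\<close>

lemma no_identity_revealing_extend:
  "no_identity_revealing M (extend h a s') \<longleftrightarrow>
     no_identity_revealing M h \<and> \<not> identity_revealing M (snd h) a s'"
  by (auto simp: no_identity_revealing_def less_Suc_eq hstate_extend haction_extend)

lemma hist_prob_extend_pos_iff:
  "hist_prob N \<pi> (extend h a s') > 0 \<longleftrightarrow>
     hist_prob N \<pi> h > 0 \<and> pmf (\<pi> h) a > 0 \<and> pmf (kernel N (snd h) a) s' > 0"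
  using hist_prob_nonneg[of N \<pi> h] pmf_nonneg[of "\<pi> h" a] pmf_nonneg[of "kernel N (snd h) a" s']
  by (auto simp: hist_prob_extend less_le)

lemma overlap_pos_iff:
  "overlap M \<pi> h > 0 \<longleftrightarrow> hist_prob (M First) \<pi> h > 0 \<and> hist_prob (M Second) \<pi> h > 0"
  by (simp add: overlap_def)

context preprocessed_policy
begin

lemma extend_base_hist_in_MI:
  assumes "base_hist (extend h a s') \<in> histories MI (Suc t)"
  shows "base_hist h \<in> histories MI t" "a \<in> acts (M First) (snd h)"
    "\<not> revealing_state M (snd h)" "s' \<in> common_supp M (snd h) a" "snd h \<in> states (M First)"
proof -
  from assms have h: "base_hist h \<in> histories MI t"
    and x: "Base a \<in> pre_acts M c (Base (snd h))"
    and y: "Base s' \<in> set_pmf (kernel MI (Base (snd h)) (Base a))"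
    by (simp_all add: extend_in_histories_iff)
  from y obtain k where "Base s' \<in> set_pmf (pre_kernel M k (Base (snd h)) (Base a))"
    unfolding set_kernel_MI by blast
  from Base_in_pre_kernel[OF x this] h show "base_hist h \<in> histories MI t" "a \<in> acts (M First) (snd h)"
    "\<not> revealing_state M (snd h)" "s' \<in> common_supp M (snd h) a" by auto
  show "snd h \<in> states (M First)"
    using snd_histories_states[OF mdp_MI h] by auto
qed

text \<open>An undecided history of the mixture is the image of a history of both original models, along which
  the prescription of the policy applies.\<close>

lemma base_hist_in_MI_D:
  assumes "base_hist h \<in> histories MI t"
  shows "h \<in> histories (M i) t" "no_identity_revealing M h"
proof -
  have "h \<in> histories (M i) t \<and> no_identity_revealing M h"
    using assms
  proof (induction t arbitrary: h)
    case 0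
    then show ?case
      by (cases h rule: hist_cases) (auto simp: init_M[of i] no_identity_revealing_def dest: hstep_histories)
  next
    case (Suc t)
    then obtain h' a s' where h: "h = extend h' a s'"
      by (cases h rule: hist_cases) auto
    note e = extend_base_hist_in_MI[OF Suc.prems[unfolded h]]
    have "s' \<in> set_pmf (kernel (M j) (snd h') a)" for j
      using e(4) idx_cases[of j] by (auto simp: common_supp_def)
    then show ?case
      using Suc.IH[OF e(1)] e(2,5) acts_M[of "snd h'" i]
      by (simp add: h extend_in_histories_iff no_identity_revealing_extend identity_revealing_def pmf_positive)
  qed
  then show "h \<in> histories (M i) t" "no_identity_revealing M h" by auto
qed

lemma histories_MI_Base:
  assumes "g \<in> histories MI t" "snd g = Base s"
  obtains h where "g = base_hist h"
proof -
  have "\<exists>h. g = base_hist h"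
    using assms
  proof (induction t arbitrary: g s)
    case 0
    then show ?case by (intro exI[of _ "([], s)"]) (auto simp: histories_0)
  next
    case (Suc t)
    from Suc.prems(1) show ?case
    proof (cases rule: histories_Suc_cases)
      case (1 h x y)
      obtain k where k: "Base s \<in> set_pmf (pre_kernel M k (snd h) x)"
        using 1(1,4) Suc.prems(2) by (auto simp: set_kernel_MI)
      obtain s0 where s0: "snd h = Base s0"
        using k by (cases "snd h") auto
      then obtain h0 where "h = base_hist h0" using Suc.IH[OF 1(2)] by blast
      moreover obtain a where "x = Base a"
        using Base_in_pre_kernel[of x M c s0 s k] k 1(3) s0 by auto
      ultimately show ?thesis
        using 1(1) Suc.prems(2) by (intro exI[of _ "extend h0 a s"]) simp
    qed
  qed
  then show ?thesis using that by blast
qed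

lemma base_hist_in_mmdp_histories:
  assumes "base_hist h \<in> histories MI t"
  shows "base_hist h \<in> mmdp_histories Mp t" "h \<in> mmdp_histories M t"
  using assms base_hist_in_MI_D[OF assms]
  by (cases rule: histories_MI_cases; simp add: mmdp_histories_def)+

context
  fixes \<pi>' :: "('s, 'a) policy"
  assumes \<pi>': "used_on M c \<pi> \<pi>'"
begin

lemma used_on_base_hist:
  assumes "base_hist h \<in> histories MI t"
  shows "pmf (\<pi>' h) a = pmf (\<pi> (base_hist h)) (Base a)"
proof -
  have "map_pmf Base (\<pi>' h) = \<pi> (base_hist h)"
    using \<pi>' base_hist_in_mmdp_histories[OF assms] base_hist_in_MI_D(2)[OF assms]
    unfolding used_on_def by blast
  then show ?thesis using pmf_map_Base[of "\<pi>' h" a] by simp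
qed

lemma hist_prob_base_hist:
  assumes "base_hist h \<in> histories MI t"
  shows "hist_prob (M i) \<pi>' h = hist_prob (Mp i) \<pi> (base_hist h)"
  using assms
proof (induction t arbitrary: h)
  case 0
  then show ?case
    by (cases h rule: hist_cases) (auto simp: init_M[of i] dest: hstep_histories)
next
  case (Suc t)
  then obtain h' a s' where h: "h = extend h' a s'"
    by (cases h rule: hist_cases) auto
  note e = extend_base_hist_in_MI[OF Suc.prems[unfolded h]]
  show ?case
    using Suc.IH[OF e(1)] used_on_base_hist[OF e(1), of a] pmf_pre_kernel_common[OF e(3,4), of i]
    by (simp add: h hist_prob_extend del: pre_kernel.simps)
qed

text \<open>Conversely, a history that both original models produce with positive probability never acts in a
  revealing state: the policy would play the retained revealing action there, and no successor of it is
  possible in both models.\<close>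

lemma base_hist_in_MI_if_overlap_pos:
  assumes "h \<in> mmdp_histories M t" "overlap M \<pi>' h > 0"
  shows "base_hist h \<in> histories MI t"
  using assms
proof (induction t arbitrary: h)
  case 0
  then show ?case by (auto simp: mmdp_histories_def histories_0 init_M[of Second])
next
  case (Suc t)
  then obtain j where "h \<in> histories (M j) (Suc t)" by (auto simp: mmdp_histories_def)
  then show ?case
  proof (cases rule: histories_Suc_cases)
    case (1 h' a s')
    have "overlap M \<pi>' h' > 0" "pmf (\<pi>' h') a > 0" and K: "pmf (kernel (M i) (snd h') a) s' > 0" for i
      using Suc.prems(2) idx_cases[of i]
      by (auto simp: 1(1) overlap_pos_iff hist_prob_extend_pos_iff)
    moreover have "h' \<in> mmdp_histories M t" using 1(2) idx_cases[of j] by (auto simp: mmdp_histories_def)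
    ultimately have h': "base_hist h' \<in> histories MI t" and "pmf (\<pi>' h') a > 0"
      using Suc.IH by auto
    then have "Base a \<in> set_pmf (\<pi> (base_hist h'))"
      by (simp add: used_on_base_hist set_pmf_iff)
    then have a: "Base a \<in> pre_acts M c (Base (snd h'))"
      using policy_MI[OF h'] by auto
    have s': "s' \<in> common_supp M (snd h') a"
      using K[of First] K[of Second] by (simp add: common_supp_def set_pmf_iff less_le)
    have s: "snd h' \<in> states (M First)"
      using snd_histories_states[OF mdp_MI h'] by auto
    have nr: "\<not> revealing_state M (snd h')"
    proof
      assume "revealing_state M (snd h')"
      then have "a = c (snd h')" "revealing_pair M (snd h') (c (snd h'))"
        using a c s by (auto simp: pre_acts_def retained_choice_def)
      then show False using s' by (simp add: revealing_pair_def)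
    qed
    have "Base s' \<in> set_pmf (kernel MI (Base (snd h')) (Base a))"
      using pmf_pre_kernel_common[OF nr s', of First] K[of First]
      by (simp add: set_kernel_MI set_pmf_iff del: pre_kernel.simps)
    then show ?thesis
      using h' a 1(1) by (simp add: extend_in_histories_iff)
  qed
qed

text \<open>\<open>base_hist\<close> matches the histories with nonzero overlap on the two sides; absorbed histories of the
  preprocessed MMDP have overlap \<open>0\<close>.\<close>

lemma sum_overlap_eq:
  "(\<Sum>h\<in>mmdp_histories M t. overlap M \<pi>' h) = (\<Sum>g\<in>histories MI t. overlap Mp \<pi> g)"
proof -
  let ?D = "{h. base_hist h \<in> histories MI t}"
  have fin: "finite (mmdp_histories M t)"
    using finite_histories[OF mdp_M] by (simp add: mmdp_histories_def)
  have "(\<Sum>h\<in>mmdp_histories M t. overlap M \<pi>' h) = (\<Sum>h\<in>?D. overlap M \<pi>' h)"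
  proof (rule sum.mono_neutral_right[OF fin])
    show "?D \<subseteq> mmdp_histories M t" using base_hist_in_mmdp_histories(2) by auto
    show "\<forall>h\<in>mmdp_histories M t - ?D. overlap M \<pi>' h = 0"
      using base_hist_in_MI_if_overlap_pos[of _ t] overlap_nonneg[of M \<pi>'] by (force simp: less_le)
  qed
  also have "\<dots> = (\<Sum>h\<in>?D. overlap Mp \<pi> (base_hist h))"
    by (intro sum.cong refl) (auto simp: overlap_def hist_prob_base_hist)
  also have "\<dots> = (\<Sum>g\<in>base_hist ` ?D. overlap Mp \<pi> g)"
    by (subst sum.reindex) (auto intro: inj_on_subset[OF inj_base_hist])
  also have "\<dots> = (\<Sum>g\<in>histories MI t. overlap Mp \<pi> g)"
  proof (rule sum.mono_neutral_left)
    show "finite (histories MI t)" using finite_histories[OF mdp_MI] .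
    show "\<forall>g\<in>histories MI t - base_hist ` ?D. overlap Mp \<pi> g = 0"
    proof
      fix g assume g: "g \<in> histories MI t - base_hist ` ?D"
      then have gI: "g \<in> histories MI t" by simp
      from gI show "overlap Mp \<pi> g = 0"
      proof (cases rule: histories_MI_cases)
        case (Base s)
        then show ?thesis using histories_MI_Base[OF gI] g by blast
      next
        case (Bot j)
        then show ?thesis
          using idx_cases[of j] hist_prob_nonneg[of "Mp First" \<pi> g] hist_prob_nonneg[of "Mp Second" \<pi> g]
          by (auto simp: overlap_def)
      qed
    qed
  qed auto
  finally show ?thesis .
qed

end

end

section \<open>Recurrent information makes the overlap vanish\<close>

context preprocessed_policy
begin

abbreviation P :: "(nat \<Rightarrow> 's with_bot \<times> 'a with_bot) measure" where
  "P \<equiv> path_measure MI \<pi>"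

text \<open>The geometric mean of the two likelihoods. It dominates their minimum and, unlike the minimum, is
  multiplicative along a history.\<close>

definition fidelity :: "('s with_bot, 'a with_bot) hist \<Rightarrow> real" where
  "fidelity g = sqrt (hist_prob (Mp First) \<pi> g * hist_prob (Mp Second) \<pi> g)"

lemma fidelity_nonneg [simp]: "fidelity g \<ge> 0"
  by (simp add: fidelity_def)

lemma overlap_le_fidelity: "overlap Mp \<pi> g \<le> fidelity g"
proof -
  have "min a b \<le> sqrt (a * b)" if "0 \<le> a" "0 \<le> b" for a b :: real
    using that by (intro real_le_rsqrt) (auto simp: power2_eq_square intro!: mult_mono)
  then show ?thesis by (simp add: overlap_def fidelity_def)
qed

lemma fidelity_extend:
  "fidelity (extend h x y) = fidelity h * pmf (\<pi> h) x *
     sqrt (pmf (pre_kernel M First (snd h) x) y * pmf (pre_kernel M Second (snd h) x) y)"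
proof -
  have "fidelity (extend h x y) = sqrt ((hist_prob (Mp First) \<pi> h * hist_prob (Mp Second) \<pi> h) *
      (pmf (\<pi> h) x * pmf (\<pi> h) x) *
      (pmf (pre_kernel M First (snd h) x) y * pmf (pre_kernel M Second (snd h) x) y))"
    unfolding fidelity_def hist_prob_extend by (simp add: ac_simps)
  then show ?thesis unfolding fidelity_def by (simp only: real_sqrt_mult real_sqrt_mult_self) simp
qed

text \<open>The supermartingale argument. One step changes the total of the extensions of \<open>h\<close> by a factor of at
  most \<open>affinity / r \<le> 1\<close> at pairs of \<open>ISAp\<close> and of at most \<open>affinity \<le> 1\<close> elsewhere; in \<open>\<bottom>\<^sub>j\<close> the
  fidelity is \<open>0\<close>, although visits continue to be counted.\<close>

lemma discounted_fidelity_le_1: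
  assumes "0 < r" and
    contraction: "\<forall>s x. (Base s, x) \<in> ISAp M \<longrightarrow> x \<in> pre_acts M c (Base s) \<longrightarrow> affinity (Base s) x \<le> r"
  shows "(\<Sum>g\<in>histories MI t. fidelity g / r ^ visits (ISAp M) g) \<le> 1"
proof (induction t)
  case 0
  then show ?case by (simp add: histories_0 visits_def fidelity_def)
next
  case (Suc t)
  let ?w = "\<lambda>g. fidelity g / r ^ visits (ISAp M) g"
  have "(\<Sum>g\<in>histories MI (Suc t). ?w g) \<le> (\<Sum>h\<in>histories MI t. ?w h)"
    unfolding sum_histories_Suc[OF mdp_MI]
  proof (rule sum_mono)
    fix h assume h: "h \<in> histories MI t"
    from h show "(\<Sum>x\<in>acts MI (snd h). \<Sum>y\<in>set_pmf (kernel MI (snd h) x). ?w (extend h x y)) \<le> ?w h"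
    proof (cases rule: histories_MI_cases)
      case (Bot j)
      then have "fidelity h = 0" using idx_cases[of j] by (auto simp: fidelity_def)
      then show ?thesis by (simp add: fidelity_extend)
    next
      case (Base s)
      have "(\<Sum>y\<in>set_pmf (kernel MI (snd h) x). ?w (extend h x y)) \<le> ?w h * pmf (\<pi> h) x"
        if x: "x \<in> acts MI (snd h)" for x
      proof -
        let ?d = "if (snd h, x) \<in> ISAp M then r else 1"
        let ?A = "affinity (snd h) x"
        have "?A \<le> ?d"
          using contraction affinity_le_1[OF snd_histories_states[OF mdp_MI h], of x] x Base(1)
          by (auto simp del: pre_kernel.simps)
        moreover have "(\<Sum>y\<in>set_pmf (kernel MI (snd h) x). ?w (extend h x y)) = ?w h * pmf (\<pi> h) x * (?A / ?d)"
          by (simp add: bhattacharyya_def set_kernel_MI fidelity_extend visits_extend sum_distrib_left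
              sum_divide_distrib mult.assoc mult.commute[of r] del: pre_kernel.simps)
        ultimately show ?thesis
          using \<open>0 < r\<close> by (simp add: mult_left_le divide_le_eq_1 del: times_divide_eq_right times_divide_eq_left)
      qed
      then have "(\<Sum>x\<in>acts MI (snd h). \<Sum>y\<in>set_pmf (kernel MI (snd h) x). ?w (extend h x y)) \<le>
          (\<Sum>x\<in>acts MI (snd h). ?w h * pmf (\<pi> h) x)"
        by (rule sum_mono)
      also have "\<dots> = ?w h" using MI.sum_policy[OF h] by (simp only: sum_distrib_left[symmetric] mult_1_right)
      finally show ?thesis .
    qed
  qed
  then show ?case using Suc by linarith
qed

text \<open>Split the histories at \<open>k\<close> visits: those with more carry overlap at most \<open>r\<^sup>k\<close>, those with fewer
  become improbable.\<close>

lemma overlap_tendsto_0_if_informed: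
  assumes "measure P {\<omega> \<in> inf_histories MI. \<exists>\<^sub>\<infinity>t. \<omega> t \<in> ISAp M} = 1"
  shows "(\<lambda>t. \<Sum>g\<in>histories MI t. overlap Mp \<pi> g) \<longlonglongrightarrow> 0"
proof (rule LIMSEQ_I)
  fix e :: real assume "0 < e"
  let ?v = "visits (ISAp M)"
  obtain r where r: "0 < r" "r < 1" and
    contraction: "\<forall>s x. (Base s, x) \<in> ISAp M \<longrightarrow> x \<in> pre_acts M c (Base s) \<longrightarrow> affinity (Base s) x \<le> r"
    using uniform_contraction by blast
  note supermartingale = discounted_fidelity_le_1[OF r(1) contraction]
  obtain k where k: "r ^ k < e / 2"
    using real_arch_pow_inv[of "e / 2" r] r \<open>0 < e\<close> by auto
  obtain t0 where t0: "\<And>t. t \<ge> t0 \<Longrightarrow> (\<Sum>g | g \<in> histories MI t \<and> ?v g < k. hist_prob MI \<pi> g) < e / 2"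
    using order_tendstoD(2)[OF MI.few_visits_tendsto_0[OF assms, of k], of "e / 2"] \<open>0 < e\<close>
    unfolding eventually_sequentially by auto
  have "(\<Sum>g\<in>histories MI t. overlap Mp \<pi> g) < e" if "t \<ge> t0" for t
  proof -
    note fin = finite_histories[OF mdp_MI, of t]
    have pointwise: "overlap Mp \<pi> g \<le>
        (if ?v g < k then hist_prob MI \<pi> g else 0) + r ^ k * (fidelity g / r ^ ?v g)" for g
    proof (cases "?v g < k")
      case True
      have "overlap Mp \<pi> g \<le> hist_prob MI \<pi> g"
        using \<gamma> by (intro overlap_le_informative) simp_all
      then show ?thesis using True r by (simp add: add_increasing2)
    next
      case False
      then have "r ^ ?v g \<le> r ^ k" using r by (intro power_decreasing) auto
      then have "fidelity g * r ^ ?v g \<le> fidelity g * r ^ k" by (intro mult_left_mono) simp_all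
      then have "fidelity g \<le> r ^ k * (fidelity g / r ^ ?v g)"
        using r(1) by (simp only: times_divide_eq_right pos_le_divide_eq zero_less_power mult.commute)
      then show ?thesis using False overlap_le_fidelity[of g] by simp
    qed
    have "(\<Sum>g\<in>histories MI t. overlap Mp \<pi> g) \<le>
        (\<Sum>g\<in>histories MI t. (if ?v g < k then hist_prob MI \<pi> g else 0) + r ^ k * (fidelity g / r ^ ?v g))"
      by (intro sum_mono pointwise)
    also have "\<dots> = (\<Sum>g | g \<in> histories MI t \<and> ?v g < k. hist_prob MI \<pi> g) +
        r ^ k * (\<Sum>g\<in>histories MI t. fidelity g / r ^ ?v g)"
      using fin by (simp only: sum.distrib sum_distrib_left sum.inter_filter)
    also have "\<dots> \<le> (\<Sum>g | g \<in> histories MI t \<and> ?v g < k. hist_prob MI \<pi> g) + r ^ k * 1"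
      using r supermartingale[of t] by (intro add_left_mono mult_left_mono) auto
    also have "\<dots> < e" using t0[OF that] k by simp
    finally show ?thesis .
  qed
  then show "\<exists>t0. \<forall>t\<ge>t0. norm ((\<Sum>g\<in>histories MI t. overlap Mp \<pi> g) - 0) < e"
    by (intro exI[of _ t0]) (simp add: sum_nonneg)
qed


section \<open>Transient information keeps the overlap positive\<close>

text \<open>Transitions between original states have a uniformly positive probability in both models, as there
  are finitely many of them.\<close>

lemma kernel_lower_bound:
  "\<exists>d. 0 < d \<and> d \<le> 1 \<and>
    (\<forall>s\<in>states (M First). \<forall>x\<in>pre_acts M c (Base s). \<forall>s' i.
       Base s' \<in> set_pmf (kernel MI (Base s) x) \<longrightarrow> d \<le> pmf (pre_kernel M i (Base s) x) (Base s'))"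
proof -
  let ?X = "\<lambda>i. (\<lambda>(s, a, s'). pmf (kernel (M i) s a) s') `
    (SIGMA s:states (M First). SIGMA a:acts (M First) s. states (M First))"
  have "finite (?X First \<union> ?X Second)"
    using is_mdpD(1,3)[OF mdp_M[of First]] by (intro finite_UnI finite_imageI finite_SigmaI)
  then obtain d where d: "0 < d" "d \<le> 1" "\<And>x. x \<in> ?X First \<union> ?X Second \<Longrightarrow> 0 < x \<Longrightarrow> d \<le> x"
    using finite_positive_lower_bound by metis
  show ?thesis
  proof (intro exI[of _ d] conjI d(1,2) ballI allI impI)
    fix s x s' i
    assume s: "s \<in> states (M First)" and x: "x \<in> pre_acts M c (Base s)"
      and y: "Base s' \<in> set_pmf (kernel MI (Base s) x)"
    from y obtain k where "Base s' \<in> set_pmf (pre_kernel M k (Base s) x)"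
      unfolding set_kernel_MI by blast
    from Base_in_pre_kernel[OF x this] obtain a where a: "x = Base a" "a \<in> acts (M First) s"
      "\<not> revealing_state M s" "s' \<in> common_supp M s a" .
    have "s' \<in> states (M First)"
      using is_mdpD(5)[OF mdp_M s a(2)] a(4) by (auto simp: common_supp_def)
    then have "pmf (kernel (M i) s a) s' \<in> ?X First \<union> ?X Second"
      using s a(2) idx_cases[of i] by force
    moreover have "pmf (kernel (M i) s a) s' > 0"
      using a(4) idx_cases[of i] by (auto simp: common_supp_def pmf_positive)
    ultimately have "d \<le> pmf (kernel (M i) s a) s'" by (rule d(3))
    then show "d \<le> pmf (pre_kernel M i (Base s) x) (Base s')"
      using pmf_pre_kernel_common[OF a(3,4), of i] a(1) by simp
  qed
qed

text \<open>The third assumption excludes revealing states. There the two preprocessed kernels differ although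
  the pair is not in \<open>ISAp\<close>.\<close>

lemma pre_kernel_eq_informative_if_not_ISAp:
  assumes "s \<in> states (M First)" "x \<in> pre_acts M c (Base s)"
    "Base s' \<in> set_pmf (kernel MI (Base s) x)" "(Base s, x) \<notin> ISAp M"
  shows "pmf (pre_kernel M i (Base s) x) y = pmf (kernel MI (Base s) x) y"
proof -
  from assms(3) obtain k where "Base s' \<in> set_pmf (pre_kernel M k (Base s) x)"
    unfolding set_kernel_MI by blast
  from Base_in_pre_kernel[OF assms(2) this] obtain a where a: "x = Base a" "a \<in> acts (M First) s"
    "\<not> revealing_state M s" .
  have "\<not> informative_pair M s a"
    using assms(1,4) a(1,2) by (force simp: ISAp_def ISA_def)
  then have "pre_kernel M First (Base s) x = pre_kernel M Second (Base s) x"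
    unfolding a(1) by (rule pre_kernel_eq_if_not_informative[OF a(2,3)])
  then show ?thesis using idx_cases[of i] by (auto simp: pmf_kernel_MI algebra_simps)
qed

text \<open>Before time \<open>T\<close> a step multiplies the ratio of the two probabilities by at least \<open>d\<close>; from \<open>T\<close> on
  the kernels agree and the ratio stays. The induction therefore carries the exponent \<open>min t T\<close>.\<close>

lemma hist_prob_ge_informative:
  assumes d: "0 < d" "d \<le> 1"
    "\<forall>s\<in>states (M First). \<forall>x\<in>pre_acts M c (Base s). \<forall>s' i.
       Base s' \<in> set_pmf (kernel MI (Base s) x) \<longrightarrow> d \<le> pmf (pre_kernel M i (Base s) x) (Base s')"
    and "g \<in> histories MI t" "snd g = Base s" "\<And>\<tau>. T \<le> \<tau> \<Longrightarrow> \<tau> < t \<Longrightarrow> fst g ! \<tau> \<notin> ISAp M"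
  shows "d ^ T * hist_prob MI \<pi> g \<le> hist_prob (Mp i) \<pi> g"
proof -
  have "d ^ min t T * hist_prob MI \<pi> g \<le> hist_prob (Mp i) \<pi> g"
    using assms(4-)
  proof (induction t arbitrary: g s)
    case 0
    then show ?case by (simp add: histories_0)
  next
    case (Suc t)
    from Suc.prems(1) show ?case
    proof (cases rule: histories_Suc_cases)
      case (1 h x y)
      have len: "length (fst h) = t" using hstep_histories[OF 1(2)] by (simp add: hstep_def)
      have y: "Base s \<in> set_pmf (kernel MI (snd h) x)" using 1(1,4) Suc.prems(2) by simp
      then obtain s0 where s0: "snd h = Base s0"
        by (cases "snd h") (auto simp: set_kernel_MI)
      then have s0M: "s0 \<in> states (M First)" using snd_histories_states[OF mdp_MI 1(2)] by auto
      have "fst h ! \<tau> \<notin> ISAp M" if "T \<le> \<tau>" "\<tau> < t" for \<tau>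
        using Suc.prems(3)[of \<tau>] that len by (simp add: 1(1) nth_append)
      note IH = Suc.IH[OF 1(2) s0 this]
      let ?KI = "pmf (kernel MI (Base s0) x) (Base s)" and ?K = "pmf (pre_kernel M i (Base s0) x) (Base s)"
      have K: "d ^ (min (Suc t) T - min t T) * ?KI \<le> ?K"
      proof (cases "t < T")
        case True
        have "d * ?KI \<le> d" using d(1) by (simp add: mult_left_le pmf_le_1)
        also have "\<dots> \<le> ?K" using d(3) s0M 1(3) y s0 by simp
        finally show ?thesis using True by simp
      next
        case False
        then have "(Base s0, x) \<notin> ISAp M"
          using Suc.prems(3)[of t] len s0 by (simp add: 1(1) nth_append)
        from pre_kernel_eq_informative_if_not_ISAp[OF s0M _ _ this] show ?thesis
          using 1(3) y s0 False by simp
      qed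
\<comment> \<open>The exponent grows by one before time \<open>T\<close> and is constant afterwards.\<close>
      have "d ^ min (Suc t) T * hist_prob MI \<pi> g =
          (d ^ min t T * hist_prob MI \<pi> h) * pmf (\<pi> h) x * (d ^ (min (Suc t) T - min t T) * ?KI)"
        using Suc.prems(2) by (simp add: 1(1) hist_prob_extend s0 flip: power_add)
      also have "\<dots> \<le> hist_prob (Mp i) \<pi> h * pmf (\<pi> h) x * ?K"
        using d(1) by (intro mult_mono IH K order_refl) auto
      also have "\<dots> = hist_prob (Mp i) \<pi> g"
        using Suc.prems(2) by (simp add: 1(1) hist_prob_extend s0)
      finally show ?thesis .
    qed
  qed
  moreover have "d ^ T \<le> d ^ min t T" using d(1,2) by (intro power_decreasing) auto
  ultimately show ?thesis
    using mult_right_mono[of "d ^ T" "d ^ min t T" "hist_prob MI \<pi> g"] by simp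
qed

text \<open>While \<open>ISAp\<close> is avoided the history is undecided, for the loops at \<open>\<bottom>\<^sub>j\<close> belong to \<open>ISAp\<close>. So the
  lower bound on both likelihoods applies on the whole event.\<close>

lemma informed_if_overlap_tendsto_0:
  assumes "(\<lambda>t. \<Sum>g\<in>histories MI t. overlap Mp \<pi> g) \<longlonglongrightarrow> 0"
  shows "measure P {\<omega> \<in> inf_histories MI. \<exists>\<^sub>\<infinity>t. \<omega> t \<in> ISAp M} = 1"
proof (rule MI.infinitely_often_AE)
  fix T
  let ?E = "{\<omega> \<in> inf_histories MI. \<forall>t\<ge>T. \<omega> t \<notin> ISAp M}"
  interpret P: prob_space P by (rule MI.prob_space_path_measure)
  obtain d where d: "0 < d" "d \<le> 1"
    "\<forall>s\<in>states (M First). \<forall>x\<in>pre_acts M c (Base s). \<forall>s' i.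
       Base s' \<in> set_pmf (kernel MI (Base s) x) \<longrightarrow> d \<le> pmf (pre_kernel M i (Base s) x) (Base s')"
    using kernel_lower_bound by blast
  have bound: "d ^ T * measure P ?E \<le> (\<Sum>g\<in>histories MI t. overlap Mp \<pi> g)" if "t \<ge> T" for t
  proof -
    let ?Q = "\<lambda>g. (\<exists>s. snd g = Base s) \<and> (\<forall>\<tau>. T \<le> \<tau> \<longrightarrow> \<tau> < t \<longrightarrow> fst g ! \<tau> \<notin> ISAp M)"
    have sub: "?E \<subseteq> {\<omega> \<in> inf_histories MI. ?Q (prefix_hist \<omega> t)}"
    proof safe
      fix \<omega> assume \<omega>: "\<omega> \<in> inf_histories MI" "\<forall>t\<ge>T. \<omega> t \<notin> ISAp M"
      show "\<exists>s. snd (prefix_hist \<omega> t) = Base s"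
      proof (cases "fst (\<omega> t)")
        case (Bot j)
        have "snd (\<omega> t) \<in> pre_acts M c (fst (\<omega> t))"
          using \<omega>(1) by (simp add: inf_histories_def)
        then have "\<omega> t = (Bot j, Bot j)" using Bot by (cases "\<omega> t") (simp add: pre_acts_def)
        then have "\<omega> t \<in> ISAp M" using idx_cases[of j] by (auto simp: ISAp_def)
        then show ?thesis using \<omega>(2) that by blast
      qed simp
      fix \<tau> assume "T \<le> \<tau>" "\<tau> < t" "fst (prefix_hist \<omega> t) ! \<tau> \<in> ISAp M"
      then show False using \<omega>(2) by (simp add: prefix_hist_def)
    qed
    have "d ^ T * measure P ?E \<le> d ^ T * measure P {\<omega> \<in> inf_histories MI. ?Q (prefix_hist \<omega> t)}"
      using d(1) sub by (intro mult_left_mono P.finite_measure_mono MI.sets_prefix_event) auto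
    also have "\<dots> = (\<Sum>g | g \<in> histories MI t \<and> ?Q g. d ^ T * hist_prob MI \<pi> g)"
      by (simp only: MI.measure_prefix_event[where Q = ?Q] sum_distrib_left)
    also have "\<dots> \<le> (\<Sum>g | g \<in> histories MI t \<and> ?Q g. overlap Mp \<pi> g)"
    proof (rule sum_mono)
      fix g assume "g \<in> {g \<in> histories MI t. ?Q g}"
      then obtain s where "g \<in> histories MI t" "snd g = Base s"
        "\<And>\<tau>. T \<le> \<tau> \<Longrightarrow> \<tau> < t \<Longrightarrow> fst g ! \<tau> \<notin> ISAp M" by blast
      note ge = hist_prob_ge_informative[OF d this]
      show "d ^ T * hist_prob MI \<pi> g \<le> overlap Mp \<pi> g"
        unfolding overlap_def by (intro min.boundedI ge)
    qed
    also have "\<dots> \<le> (\<Sum>g\<in>histories MI t. overlap Mp \<pi> g)"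
      using finite_histories[OF mdp_MI, of t] by (intro sum_mono2) auto
    finally show ?thesis .
  qed
  have "d ^ T * measure P ?E \<le> 0"
    using bound by (intro LIMSEQ_le_const[OF assms]) blast
  moreover have "0 < d ^ T" using d(1) by simp
  ultimately show "measure P ?E = 0"
    using measure_nonneg[of P ?E] by (simp add: mult_le_0_iff)
qed


section \<open>The characterisation\<close>

lemma achieves_APD_iff_informed:
  assumes "used_on M c \<pi> \<pi>'"
  shows "achieves_APD M \<pi>' \<longleftrightarrow>
    measure P {\<omega> \<in> inf_histories MI. inft \<omega> \<inter> ISAp M \<noteq> {}} = 1"
proof -
  have "achieves_APD M \<pi>' \<longleftrightarrow> (\<lambda>t. \<Sum>h\<in>mmdp_histories M t. overlap M \<pi>' h) \<longlonglongrightarrow> 0"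
    using finite_histories[OF mdp_M] by (intro achieves_APD_iff_overlap) (simp add: mmdp_histories_def)
  also have "\<dots> \<longleftrightarrow> (\<lambda>t. \<Sum>g\<in>histories MI t. overlap Mp \<pi> g) \<longlonglongrightarrow> 0"
    by (simp only: sum_overlap_eq[OF assms])
  also have "\<dots> \<longleftrightarrow> measure P {\<omega> \<in> inf_histories MI. \<exists>\<^sub>\<infinity>t. \<omega> t \<in> ISAp M} = 1"
    using overlap_tendsto_0_if_informed informed_if_overlap_tendsto_0 by blast
  finally show ?thesis by (simp only: inft_Int_nonempty_iff[OF finite_ISAp[OF mdp_M]])
qed

end

theorem theorem1:
  fixes M :: "('s, 'a) mmdp"
    and c :: "'s \<Rightarrow> 'a"
    and \<gamma> :: real
    and \<pi> :: "('s with_bot, 'a with_bot) policy"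
    and \<pi>' :: "('s, 'a) policy"
  assumes "binary_mmdp M"
    and "retained_choice M c"
    and "\<gamma> \<in> {0<..<1}"
    and "is_policy (preprocessed M c) \<pi>"
    and "used_on M c \<pi> \<pi>'"
  shows "achieves_APD M \<pi>' \<longleftrightarrow>
    measure (path_measure (informative_mdp (preprocessed M c) \<gamma>) \<pi>)
      {h \<in> inf_histories (informative_mdp (preprocessed M c) \<gamma>). inft h \<inter> ISAp M \<noteq> {}} = 1"
proof -
  interpret preprocessed_policy M c \<gamma> \<pi>
    using assms(1-4) by unfold_locales
  show ?thesis by (rule achieves_APD_iff_informed[OF assms(5)])
qed

end
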